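(* Let $\theta$ be fixed, let $M(\xi,\theta)=P(\theta)C(\xi,\theta)P^T(\theta)$ be the information matrix of a design $\xi$ on $[A,B]$, where $P(\theta)$ is a nonsingular $p\times p$ matrix not depending on $\xi$ and $C(\xi,\theta)=\big(\int_A^B\Psi_{ij}(x)\,d\xi(x)\big)_{i,j=1}^p$. Let $\Psi_1,\dots,\Psi_k$ denote the $k$ different functions among $\{\Psi_{ij}\mid 1\le i,j\le p\}$ which are not equal to a constant function, and assume that for some $l\in\{1,\dots,p\}$ $$\Psi_k=\Psi_{ll}\quad\text{and}\quad\Psi_{ij}\ne\Psi_k\ \text{ for all }(i,j)\ne(l,l).$$ Assume that $\Psi_j$ is $(j+1)$ times continuously differentiable for each $j=1,\dots,k$. Define $w_0=1$ and, for $j=0,\dots,k-1$, $$w_{j+1}=D_jD_{j-1}\cdots D_0\Psi_{j+1},\qquad\text{where } D_jf=\frac{d}{dx}\Big(\frac{f}{w_j}\Big),$$ and assume that $$F(x)=w_1(x)\cdots w_k(x)\ne0\quad\text{for all }x\in[A,B]$$ (so that each $w_j$ has no zero on $[A,B]$ and the recursion is well defined). Then for any given design $\xi$ there exists a design $\tilde\xi$ such that $I(\tilde\xi)\le\frac k2$ and $$M(\tilde\xi,\theta)\ge M(\xi,\theta).$$ If $I(\xi)<\frac k2$, then $\tilde\xi$ is uniquely determined in the class of all designs $\eta$ satisfying $\int_A^B\Psi_i\,d\eta=\int_A^B\Psi_i\,d\xi$ for $i=0,\dots,k-1$ (with $\Psi_0=1$), and coincides with $\xi$ (that is, $\xi$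 is the only design in this class, and $\tilde\xi=\xi$). Otherwise, i.e. if $I(\xi)\ge\frac k2$, the following hold: (1a) If $k$ is odd and $F(x)<0$ on $[A,B]$, then $\tilde\xi$ has at most $(k+1)/2$ support points and $\tilde\xi$ can be chosen such that $A$ is a support point. (1b) If $k$ is odd and $F(x)>0$ on $[A,B]$, then $\tilde\xi$ has at most $(k+1)/2$ support points and $\tilde\xi$ can be chosen such that $B$ is a support point. (2a) If $k$ is even and $F(x)<0$ on $[A,B]$, then $\tilde\xi$ has at most $k/2$ support points. (2b) If $k$ is even and $F(x)>0$ on $[A,B]$, then $\tilde\xi$ has at most $k/2+1$ support points and $\tilde\xi$ can be chosen such that $A$ and $B$ are support points. Here in (1a)--(2b) the assertion is that a design with the stated properties exists whose information matrix is $\ge M(\xi,\theta)$.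
   Context: $[A,B]\subset\mathbb{R}$ is a compact interval (the design space). A design is a probability measure on $[A,B]$ with finite support. In the nonlinear regression model $Y=\eta(x,\theta)+\varepsilon$ with parameter $\theta\in\Theta\subset\mathbb{R}^p$, the information matrix of a design $\xi$ is $M(\xi,\theta)=\int_A^B\big(\frac{\partial}{\partial\theta}\eta(x,\theta)\big)\big(\frac{\partial}{\partial\theta}\eta(x,\theta)\big)^T d\xi(x)$; it is assumed to have the representation $M=PCP^T$ given in the claim, with functions $\Psi_{ij}=\Psi_{ji}$ on $[A,B]$ (which may depend on the fixed $\theta$). (In the integral formula $\eta$ is the regression function; in the claim $\eta$ denotes a design.) Matrix inequalities refer to the Loewner ordering: $M_1\le M_2$ means $M_2-M_1$ is nonnegative definite. The index $I(\xi)$ of a design $\xi$ is the number of its support points, where the boundary points $A$ and $B$ (if they occur as support points) are each counted only by $1/2$. *)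

theory Defs
  imports "HOL-Analysis.Analysis" "HOL-Probability.Probability_Mass_Function"
begin

definition design :: "real \<Rightarrow> real \<Rightarrow> real pmf \<Rightarrow> bool" where
  "design A B \<xi> \<longleftrightarrow> finite (set_pmf \<xi>) \<and> set_pmf \<xi> \<subseteq> {A..B}"

definition design_index :: "real \<Rightarrow> real \<Rightarrow> real pmf \<Rightarrow> real" where
  "design_index A B \<xi> =
     real (card (set_pmf \<xi> - {A, B})) + real (card (set_pmf \<xi> \<inter> {A, B})) / 2"

text \<open>The partial derivatives are taken along \<open>\<Theta>\<close>, so that \<open>\<theta>\<close> may be a boundary point of
  the parameter set; for interior \<open>\<theta>\<close> they are the ordinary partial derivatives.\<close>

definition parameter_gradient ::
    "(real \<Rightarrow> real^'p \<Rightarrow> real) \<Rightarrow> (real^'p) set \<Rightarrow> real^'p \<Rightarrow> real \<Rightarrow> real^'p \<Rightarrow> bool" where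
  "parameter_gradient \<eta> \<Theta> \<theta> x v \<longleftrightarrow>
     (\<forall>i. ((\<lambda>s. \<eta> x (\<theta> + s *\<^sub>R axis i 1)) has_real_derivative v $ i)
            (at 0 within {s. \<theta> + s *\<^sub>R axis i 1 \<in> \<Theta>}))"

text \<open>Here \<open>g x\<close> is the gradient of the regression function at \<open>x\<close>, for the fixed parameter.\<close>

definition info_matrix :: "(real \<Rightarrow> real^'p) \<Rightarrow> real pmf \<Rightarrow> real^'p^'p" where
  "info_matrix g \<xi> = (\<chi> i j. measure_pmf.expectation \<xi> (\<lambda>x. g x $ i * g x $ j))"

definition moment_matrix :: "('p \<Rightarrow> 'p \<Rightarrow> real \<Rightarrow> real) \<Rightarrow> real pmf \<Rightarrow> real^'p^'p" where
  "moment_matrix \<Psi> \<xi> = (\<chi> i j. measure_pmf.expectation \<xi> (\<Psi> i j))"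

definition nonneg_definite :: "real^'p^'p \<Rightarrow> bool" where
  "nonneg_definite M \<longleftrightarrow> transpose M = M \<and> (\<forall>v. 0 \<le> v \<bullet> (M *v v))"

definition loewner_le :: "real^'p^'p \<Rightarrow> real^'p^'p \<Rightarrow> bool" where
  "loewner_le M N \<longleftrightarrow> nonneg_definite (N - M)"

text \<open>Derivatives are taken within \<open>S\<close>; for \<open>S = {A..B}\<close> they are one-sided at the endpoints.\<close>

fun times_cont_diff_on :: "nat \<Rightarrow> (real \<Rightarrow> real) \<Rightarrow> real set \<Rightarrow> bool" where
  "times_cont_diff_on 0 f S \<longleftrightarrow> continuous_on S f"
| "times_cont_diff_on (Suc n) f S \<longleftrightarrow>
     (\<exists>f'. (\<forall>x\<in>S. (f has_real_derivative f' x) (at x within S)) \<and> times_cont_diff_on n f' S)"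

definition quot_deriv :: "real set \<Rightarrow> (real \<Rightarrow> real) \<Rightarrow> (real \<Rightarrow> real) \<Rightarrow> real \<Rightarrow> real" where
  "quot_deriv S w f = (\<lambda>x. vector_derivative (\<lambda>y. f y / w y) (at x within S))"

text \<open>With \<open>D\<^sub>i = quot_deriv S (w_seq S \<psi> i)\<close>, the fold applies \<open>D\<^sub>0\<close> first and \<open>D\<^sub>j\<close> last.\<close>

fun w_seq :: "real set \<Rightarrow> (nat \<Rightarrow> real \<Rightarrow> real) \<Rightarrow> nat \<Rightarrow> real \<Rightarrow> real" where
  "w_seq S \<psi> 0 = (\<lambda>x. 1)"
| "w_seq S \<psi> (Suc j) = fold (\<lambda>i f. quot_deriv S (w_seq S \<psi> i) f) [0..<Suc j] (\<psi> (Suc j))"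

text \<open>\<open>vector_derivative\<close> is unspecified where no derivative exists, so the existence of every
  derivative occurring in \<open>w\<^sub>1, \<dots>, w\<^sub>k\<close> is stated separately. It does not follow from
  \<open>\<psi>\<^sub>j\<close> being \<open>j + 1\<close> times continuously differentiable: \<open>w\<^sub>3 = ((\<psi>\<^sub>3'/w\<^sub>1)'/w\<^sub>2)'\<close> involves
  \<open>w\<^sub>1''\<close>, hence formally the third derivative of \<open>\<psi>\<^sub>1\<close>.\<close>

definition w_seq_well_defined :: "real set \<Rightarrow> (nat \<Rightarrow> real \<Rightarrow> real) \<Rightarrow> nat \<Rightarrow> bool" where
  "w_seq_well_defined S \<psi> k \<longleftrightarrow>
     (\<forall>j<k. \<forall>i\<le>j.
        (\<lambda>x. fold (\<lambda>r f. quot_deriv S (w_seq S \<psi> r) f) [0..<i] (\<psi> (Suc j)) x / w_seq S \<psi> i x)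
          differentiable_on S)"

end

theory Submission
  imports Defs
begin

text \<open>Since no \<open>w\<^sub>j\<close> vanishes, Rolle's theorem applied to the successive quotients makes
  \<open>1, \<psi>\<^sub>1, \<dots>, \<psi>\<^sub>k\<close> a Chebyshev system, in which the leading coefficient of a combination that
  alternates on \<open>k + 1\<close> points has the sign of \<open>F\<close>. Dually, a signed measure on \<open>k + 1\<close> points
  annihilating \<open>1, \<psi>\<^sub>1, \<dots>, \<psi>\<^bsub>k-1\<^esub>\<close> alternates in sign, and \<open>F\<close> decides whether its last weight
  has the sign of its \<open>\<psi>\<^sub>k\<close>-moment. Take a design with the moments of \<open>\<xi>\<close> up to \<open>\<psi>\<^bsub>k-1\<^esub>\<close> and, by
  compactness, maximal \<open>\<psi>\<^sub>k\<close>-moment. If its support were too large, an annihilator with negative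
  weights only on that support could be added to increase the \<open>\<psi>\<^sub>k\<close>-moment. This bounds the index
  by \<open>k/2\<close>. The difference of two designs with equal moments has \<open>k\<close> sign changes, so an index below
  \<open>k/2\<close> determines the design; hence the maximiser attains the bound when \<open>\<xi>\<close> does, which forces the
  required endpoints into its support. Only the entry \<open>(l, l)\<close> of the moment matrix changes, and it
  grows.\<close>

section \<open>Signs of derivatives, homogeneous linear systems and iterated mean values\<close>

text \<open>Darboux's argument, valid for a discontinuous \<open>f'\<close>: \<open>f\<close> falls
  to the right of \<open>x\<close> and rises towards \<open>y\<close>, so its minimum over the
  compact interval is interior and the derivative vanishes there.\<close>

lemma derivative_neg_then_pos_has_zero:
  fixes f f' :: "real \<Rightarrow> real"
  assumes "x < y"
    and der: "\<And>t. t \<in> {x..y} \<Longrightarrow> (f has_real_derivative f' t) (at t within {x..y})"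
    and "f' x < 0" "0 < f' y"
  shows "\<exists>t\<in>{x..y}. f' t = 0"
proof -
  have "continuous_on {x..y} f"
    by (meson DERIV_continuous_on der)
  then obtain m where m: "m \<in> {x..y}" "\<And>t. t \<in> {x..y} \<Longrightarrow> f m \<le> f t"
    using continuous_attains_inf[of "{x..y}" f] \<open>x < y\<close> by auto
  obtain d where d: "d > 0" "\<And>h. \<lbrakk>h > 0; x + h \<in> {x..y}; h < d\<rbrakk> \<Longrightarrow> f (x + h) < f x"
    using has_real_derivative_neg_dec_right[OF der[of x] \<open>f' x < 0\<close>] \<open>x < y\<close> by auto
  obtain e where e: "e > 0" "\<And>h. \<lbrakk>h > 0; y - h \<in> {x..y}; h < e\<rbrakk> \<Longrightarrow> f (y - h) < f y"
    using has_real_derivative_pos_inc_left[OF der[of y] \<open>0 < f' y\<close>] \<open>x < y\<close> by auto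
  have "f (x + min (d/2) (y - x)) < f x"
    using d(1) \<open>x < y\<close> by (intro d(2)) auto
  moreover have "f m \<le> f (x + min (d/2) (y - x))"
    using d(1) \<open>x < y\<close> by (intro m(2)) auto
  ultimately have "m \<noteq> x"
    by auto
  have "f (y - min (e/2) (y - x)) < f y"
    using e(1) \<open>x < y\<close> by (intro e(2)) auto
  moreover have "f m \<le> f (y - min (e/2) (y - x))"
    using e(1) \<open>x < y\<close> by (intro m(2)) auto
  ultimately have "m \<noteq> y"
    by auto
  have inner: "x < m" "m < y"
    using m(1) \<open>m \<noteq> x\<close> \<open>m \<noteq> y\<close> by auto
  have "(f has_real_derivative f' m) (at m)"
    using der[OF m(1)] inner at_within_Icc_at[of x m y] by auto
  then have "f' m = 0"
    by (rule DERIV_local_min[of _ _ _ "min (m - x) (y - m)"]) (use inner m(2) in \<open>auto simp: abs_less_iff\<close>)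
  then show ?thesis
    using m(1) by blast
qed

text \<open>Darboux's property, applied to \<open>f\<close> or to \<open>- f\<close>, excludes a
  change of sign. It serves the functions \<open>w_seq\<close>, which are available as
  derivatives.\<close>

lemma nonzero_derivative_same_sign:
  fixes f f' :: "real \<Rightarrow> real"
  assumes der: "\<And>t. t \<in> {A..B} \<Longrightarrow> (f has_real_derivative f' t) (at t within {A..B})"
    and nz: "\<And>t. t \<in> {A..B} \<Longrightarrow> f' t \<noteq> 0"
    and xy: "x \<in> {A..B}" "y \<in> {A..B}"
  shows "0 < f' x * f' y"
proof (rule ccontr)
  assume neg: "\<not> 0 < f' x * f' y"
  have der': "(f has_real_derivative f' t) (at t within {u..v})"
    "((\<lambda>t. - f t) has_real_derivative - f' t) (at t within {u..v})"
    if "u \<in> {A..B}" "v \<in> {A..B}" "t \<in> {u..v}" for t u v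
    using that by (auto intro!: DERIV_subset[OF der] DERIV_minus)
  have *: False if "u \<in> {A..B}" "v \<in> {A..B}" "u < v" "f' u * f' v < 0" for u v
  proof (cases "f' u < 0")
    case True
    then have "0 < f' v"
      using that by (simp add: mult_less_0_iff)
    then show False
      using derivative_neg_then_pos_has_zero[of u v f f'] der' True that nz by fastforce
  next
    case False
    then have "0 < f' u" "f' v < 0"
      using that by (auto simp: mult_less_0_iff)
    then show False
      using derivative_neg_then_pos_has_zero[of u v "\<lambda>t. - f t" "\<lambda>t. - f' t"] der' that nz
      by fastforce
  qed
  have "f' x * f' y < 0"
    using neg nz xy by (simp add: not_less order_less_le)
  moreover have "x \<noteq> y"
    using neg nz[OF xy(1)] not_real_square_gt_zero[of "f' x"] by blast
  ultimately show False
    using *[of x y] *[of y x] xy by (cases x y rule: linorder_cases) (auto simp: mult.commute)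
qed

text \<open>Gaussian elimination by induction on the equations: with a pivot \<open>a i p\<close>,
  row \<open>i\<close> removes the unknown \<open>p\<close> from the other rows, and
  \<open>q\<close> is recovered from row \<open>i\<close> afterwards.\<close>

lemma homogeneous_system_has_solution:
  fixes a :: "'i \<Rightarrow> 'j \<Rightarrow> 'f::field"
  assumes "finite I" "finite J" "card I < card J"
  shows "\<exists>c. (\<exists>j\<in>J. c j \<noteq> 0) \<and> (\<forall>i\<in>I. (\<Sum>j\<in>J. a i j * c j) = 0)"
  using assms
proof (induction I arbitrary: J a rule: finite_induct)
  case empty
  then show ?case
    by (intro exI[of _ "\<lambda>_. 1"]) (auto simp: card_gt_0_iff)
next
  case (insert i I)
  show ?case
  proof (cases "\<forall>j\<in>J. a i j = 0")
    case True
    have "\<exists>c. (\<exists>j\<in>J. c j \<noteq> 0) \<and> (\<forall>i\<in>I. (\<Sum>j\<in>J. a i j * c j) = 0)"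
      using insert by (intro insert.IH) auto
    then show ?thesis
      using True by auto
  next
    case False
    then obtain p where p: "p \<in> J" "a i p \<noteq> 0"
      by blast
    define J' where "J' = J - {p}"
    have J: "J = insert p J'" "p \<notin> J'" "finite J'"
      using p insert.prems by (auto simp: J'_def)
    have "card I < card J'"
      using insert.prems insert.hyps J by simp
    then obtain c where c: "\<exists>j\<in>J'. c j \<noteq> 0"
      "\<And>i'. i' \<in> I \<Longrightarrow> (\<Sum>j\<in>J'. (a i' j - a i' p / a i p * a i j) * c j) = 0"
      using insert.IH[of J' "\<lambda>i' j. a i' j - a i' p / a i p * a i j"] J(3) by blast
    define q where "q = - (\<Sum>j\<in>J'. a i j * c j) / a i p"
    define c' where "c' = c(p := q)"
    have sum: "(\<Sum>j\<in>J. a i' j * c' j) = a i' p * q + (\<Sum>j\<in>J'. a i' j * c j)" for i'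
      using J by (auto simp: c'_def intro!: sum.cong)
    have "(\<Sum>j\<in>J. a i' j * c' j) = 0" if "i' \<in> insert i I" for i'
    proof (cases "i' = i")
      case True
      then show ?thesis
        using p by (simp add: sum q_def)
    next
      case False
      define r where "r = a i' p / a i p"
      have "(\<Sum>j\<in>J'. (a i' j - r * a i j) * c j) = 0"
        unfolding r_def using c(2)[of i'] that False by blast
      then have "(\<Sum>j\<in>J'. a i' j * c j) = r * (\<Sum>j\<in>J'. a i j * c j)"
        by (simp add: left_diff_distrib sum_subtractf sum_distrib_left mult.assoc)
      moreover have "a i' p = r * a i p"
        using p by (simp add: r_def)
      moreover have "a i p * q = - (\<Sum>j\<in>J'. a i j * c j)"
        using p by (simp add: q_def)
      ultimately show ?thesis
        unfolding sum by (metis add.commute add.right_inverse mult.assoc mult_minus_right)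
    qed
    moreover have "\<exists>j\<in>J. c' j \<noteq> 0"
      using c(1) J by (auto simp: c'_def)
    ultimately show ?thesis
      by blast
  qed
qed

text \<open>Between consecutive values of \<open>v i\<close> with alternating signs
  there is a point where \<open>v (Suc i)\<close> has the sign of the increment divided by \<open>w i\<close>.\<close>

lemma iterated_mean_value_sign:
  fixes v w :: "nat \<Rightarrow> real \<Rightarrow> real" and y :: "nat \<Rightarrow> real"
  assumes "\<And>i x. \<lbrakk>i < m; x \<in> {A..B}\<rbrakk> \<Longrightarrow>
      (v i has_real_derivative w i x * v (Suc i) x) (at x within {A..B})"
    and "\<And>i x. \<lbrakk>i < m; x \<in> {A..B}\<rbrakk> \<Longrightarrow> 0 < \<epsilon> i * w i x"
    and "strict_mono_on {..m} y" "y ` {..m} \<subseteq> {A..B}"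
    and "\<And>i. i \<le> m \<Longrightarrow> 0 \<le> (-1) ^ (m - i) * v 0 (y i)"
  shows "\<exists>x\<in>{A..B}. 0 \<le> v m x * (\<Prod>i<m. \<epsilon> i) \<and>
    ((\<exists>i\<le>m. v 0 (y i) \<noteq> 0) \<longrightarrow> 0 < v m x * (\<Prod>i<m. \<epsilon> i))"
  using assms
proof (induction m arbitrary: v w y \<epsilon>)
  case 0
  then show ?case
    by (intro bexI[of _ "y 0"]) auto
next
  case (Suc m)
  define \<delta> where "\<delta> r = v 0 (y (Suc r)) - v 0 (y r)" for r
  have ylt: "y r < y (Suc r)" if "r \<le> m" for r
    using Suc.prems(3) that by (auto simp: strict_mono_on_def)
  have yin: "y r \<in> {A..B}" if "r \<le> Suc m" for r
    using Suc.prems(4) that by auto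
  have "\<exists>z. y r < z \<and> z < y (Suc r) \<and> \<delta> r = (y (Suc r) - y r) * (w 0 z * v 1 z)" if "r \<le> m" for r
  proof -
    have sub: "{y r..y (Suc r)} \<subseteq> {A..B}"
      using yin[of r] yin[of "Suc r"] that by auto
    have "((v 0) has_derivative (*) (w 0 x * v 1 x)) (at x within {y r..y (Suc r)})"
      if "y r \<le> x" "x \<le> y (Suc r)" for x
      using Suc.prems(1)[of 0 x] that sub
      by (auto simp: has_field_derivative_def intro: has_derivative_subset)
    from mvt_simple[OF ylt[OF that] this] show ?thesis
      by (auto simp: \<delta>_def mult.commute)
  qed
  then obtain z where z: "\<And>r. r \<le> m \<Longrightarrow> y r < z r \<and> z r < y (Suc r)"
    and zd: "\<And>r. r \<le> m \<Longrightarrow> \<delta> r = (y (Suc r) - y r) * (w 0 (z r) * v 1 (z r))"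
    by metis
  have zin: "z r \<in> {A..B}" if "r \<le> m" for r
    using z[OF that] yin[of r] yin[of "Suc r"] that by auto
  have zmono: "strict_mono_on {..m} z"
  proof (rule strict_mono_onI)
    fix r t assume rt: "r \<in> {..m}" "t \<in> {..m}" "r < t"
    then have "y (Suc r) \<le> y t"
      using Suc.prems(3) by (cases "Suc r = t") (auto simp: strict_mono_on_def less_imp_le)
    then show "z r < z t"
      using z[of r] z[of t] rt by auto
  qed
  \<comment> \<open>Consecutive values have opposite signs, so the signed increment is a sum of two
    nonnegative terms and nothing cancels.\<close>
  have \<delta>: "(-1) ^ (m - r) * \<delta> r =
      (-1) ^ (Suc m - Suc r) * v 0 (y (Suc r)) + (-1) ^ (Suc m - r) * v 0 (y r)" if "r \<le> m" for r
    using that by (simp add: \<delta>_def Suc_diff_le algebra_simps)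
  have \<delta>_nonneg: "0 \<le> (-1) ^ (m - r) * \<delta> r" if "r \<le> m" for r
    unfolding \<delta>[OF that] using Suc.prems(5)[of r] Suc.prems(5)[of "Suc r"] that by simp
  have \<delta>_pos: "0 < (-1) ^ (m - r) * \<delta> r" if "r \<le> m" "v 0 (y r) \<noteq> 0 \<or> v 0 (y (Suc r)) \<noteq> 0" for r
  proof -
    have "0 \<le> (-1) ^ (Suc m - Suc r) * v 0 (y (Suc r))" "0 \<le> (-1) ^ (Suc m - r) * v 0 (y r)"
      using Suc.prems(5)[of r] Suc.prems(5)[of "Suc r"] that by auto
    moreover have "(-1) ^ (Suc m - Suc r) * v 0 (y (Suc r)) \<noteq> 0 \<or> (-1) ^ (Suc m - r) * v 0 (y r) \<noteq> 0"
      using that by auto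
    ultimately show ?thesis
      unfolding \<delta>[OF that(1)] by linarith
  qed
  \<comment> \<open>The factor \<open>\<epsilon> 0\<close> has the sign of \<open>w 0\<close>.
    Absorbing it makes \<open>V 0\<close> alternate at the new nodes \<open>z\<close> exactly as the
    increments do, which is what the induction hypothesis asks for.\<close>
  define V where "V i x = \<epsilon> 0 * v (Suc i) x" for i x
  have fac: "(-1) ^ (m - r) * V 0 (z r)
      = (-1) ^ (m - r) * \<delta> r * (\<epsilon> 0 * w 0 (z r)) / ((y (Suc r) - y r) * (w 0 (z r))\<^sup>2)"
    if "r \<le> m" for r
    using ylt[OF that] Suc.prems(2)[of 0 "z r"] zin[OF that] zd[OF that]
    by (auto simp: V_def power2_eq_square divide_simps)
  have dpos: "0 < (y (Suc r) - y r) * (w 0 (z r))\<^sup>2" and wz: "0 < \<epsilon> 0 * w 0 (z r)" if "r \<le> m" for r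
  proof -
    show "0 < \<epsilon> 0 * w 0 (z r)"
      using Suc.prems(2)[of 0 "z r"] zin[OF that] by blast
    then have "w 0 (z r) \<noteq> 0"
      by force
    then show "0 < (y (Suc r) - y r) * (w 0 (z r))\<^sup>2"
      using ylt[OF that] by (intro mult_pos_pos) auto
  qed
  have ih: "\<exists>x\<in>{A..B}. 0 \<le> V m x * (\<Prod>i<m. \<epsilon> (Suc i)) \<and>
    ((\<exists>i\<le>m. V 0 (z i) \<noteq> 0) \<longrightarrow> 0 < V m x * (\<Prod>i<m. \<epsilon> (Suc i)))"
  proof (rule Suc.IH[where w = "\<lambda>i. w (Suc i)"])
    show "(V i has_real_derivative w (Suc i) x * V (Suc i) x) (at x within {A..B})"
      if "i < m" "x \<in> {A..B}" for i x
      unfolding V_def using Suc.prems(1)[of "Suc i" x] that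
      by (auto intro!: derivative_eq_intros)
    show "0 < \<epsilon> (Suc i) * w (Suc i) x" if "i < m" "x \<in> {A..B}" for i x
      using Suc.prems(2) that by auto
    show "0 \<le> (-1) ^ (m - i) * V 0 (z i)" if "i \<le> m" for i
      unfolding fac[OF that]
      by (intro divide_nonneg_pos mult_nonneg_nonneg \<delta>_nonneg less_imp_le[OF wz] dpos that)
  qed (use zmono in simp, use zin in blast)
  then obtain x where x: "x \<in> {A..B}" "0 \<le> V m x * (\<Prod>i<m. \<epsilon> (Suc i))"
    "(\<exists>i\<le>m. V 0 (z i) \<noteq> 0) \<Longrightarrow> 0 < V m x * (\<Prod>i<m. \<epsilon> (Suc i))"
    by blast
  have "\<exists>i\<le>m. V 0 (z i) \<noteq> 0" if "\<exists>i\<le>Suc m. v 0 (y i) \<noteq> 0"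
  proof -
    obtain r where r: "r \<le> m" "v 0 (y r) \<noteq> 0 \<or> v 0 (y (Suc r)) \<noteq> 0"
    proof -
      obtain i where "i \<le> Suc m" "v 0 (y i) \<noteq> 0"
        using \<open>\<exists>i\<le>Suc m. v 0 (y i) \<noteq> 0\<close> by blast
      then show thesis
        using that[of "i - 1"] that[of 0] by (cases i) auto
    qed
    have "0 < (-1) ^ (m - r) * V 0 (z r)"
      unfolding fac[OF r(1)]
      by (rule divide_pos_pos[OF mult_pos_pos[OF \<delta>_pos[OF r] wz[OF r(1)]] dpos[OF r(1)]])
    then show ?thesis
      using r(1) by (intro exI[of _ r]) auto
  qed
  moreover have "v (Suc m) x * (\<Prod>i<Suc m. \<epsilon> i) = V m x * (\<Prod>i<m. \<epsilon> (Suc i))"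
    by (simp add: V_def prod.lessThan_Suc_shift del: prod.lessThan_Suc)
  ultimately show ?case
    using x by (intro bexI[of _ x]) auto
qed

lemma finite_set_strict_mono_enumeration:
  fixes T :: "real set"
  assumes "finite T"
  obtains y :: "nat \<Rightarrow> real" where "bij_betw y {..<card T} T" "strict_mono_on {..<card T} y"
proof
  show "bij_betw ((!) (sorted_list_of_set T)) {..<card T} T"
    using assms by (intro bij_betw_nth) auto
  show "strict_mono_on {..<card T} ((!) (sorted_list_of_set T))"
    by (intro strict_mono_onI) (auto intro: sorted_wrt_nth_less)
qed

section \<open>Finitely supported designs, their perturbation and their coordinates\<close>

lemma expectation_finite_support:
  assumes "finite S" "set_pmf \<xi> \<subseteq> S"
  shows "measure_pmf.expectation \<xi> f = (\<Sum>x\<in>S. pmf \<xi> x * f x :: real)"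
  using assms by (subst integral_measure_pmf_real[of S]) (auto simp: mult.commute)

lemma expectation_design_cong:
  assumes "design A B \<xi>" "\<And>x. x \<in> {A..B} \<Longrightarrow> f x = (g x :: real)"
  shows "measure_pmf.expectation \<xi> f = measure_pmf.expectation \<xi> g"
  using assms by (intro integral_cong_AE) (auto simp: AE_measure_pmf_iff design_def subset_iff)

lemma pmf_with_weights_exists:
  fixes w :: "'a \<Rightarrow> real"
  assumes "finite S" "\<And>x. x \<in> S \<Longrightarrow> 0 \<le> w x" "(\<Sum>x\<in>S. w x) = 1"
  obtains p where "set_pmf p \<subseteq> S" "\<And>x. x \<in> S \<Longrightarrow> pmf p x = w x"
proof -
  define w' where "w' x = (if x \<in> S then w x else 0)" for x
  have nonneg: "\<And>x. 0 \<le> w' x"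
    using assms by (simp add: w'_def)
  have "(\<integral>\<^sup>+ x. ennreal (w' x) \<partial>count_space UNIV) = (\<Sum>x\<in>S. ennreal (w' x))"
    using assms(1) by (intro nn_integral_count_space') (auto simp: w'_def)
  also have "\<dots> = ennreal (\<Sum>x\<in>S. w' x)"
    using nonneg by simp
  also have "(\<Sum>x\<in>S. w' x) = 1"
    using assms(3) by (simp add: w'_def)
  finally have total: "(\<integral>\<^sup>+ x. ennreal (w' x) \<partial>count_space UNIV) = 1"
    by simp
  show thesis
  proof
    show "set_pmf (embed_pmf w') \<subseteq> S"
      unfolding set_embed_pmf[OF nonneg total] by (auto simp: w'_def)
    show "pmf (embed_pmf w') x = w x" if "x \<in> S" for x
      unfolding pmf_embed_pmf[OF nonneg total] using that by (simp add: w'_def)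
  qed
qed

text \<open>The ratio test of the simplex method: the smallest quotient is the largest step
  \<open>t\<close> for which \<open>p - t * q\<close> stays nonnegative on \<open>N\<close>, and a
  minimiser drops to zero.\<close>

lemma minimal_ratio_exists:
  fixes p q :: "'a \<Rightarrow> real"
  assumes "finite N" "N \<noteq> {}" and pos: "\<And>x. x \<in> N \<Longrightarrow> 0 < p x" "\<And>x. x \<in> N \<Longrightarrow> 0 < q x"
  obtains t x where "0 < t" "\<And>x. x \<in> N \<Longrightarrow> t * q x \<le> p x" "x \<in> N" "t * q x = p x"
proof -
  define t where "t = Min ((\<lambda>x. p x / q x) ` N)"
  have "t \<in> (\<lambda>x. p x / q x) ` N"
    unfolding t_def using assms by (intro Min_in) auto
  then obtain x where x: "x \<in> N" "t = p x / q x"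
    by blast
  have le: "t \<le> p z / q z" if "z \<in> N" for z
    unfolding t_def using assms that by (intro Min_le) auto
  show thesis
  proof (rule that)
    show "0 < t" "t * q x = p x"
      using x pos[of x] by auto
    show "t * q z \<le> p z" if "z \<in> N" for z
      using le[OF that] pos(2)[OF that] by (simp add: pos_le_divide_eq)
  qed (rule x(1))
qed

text \<open>Moves the weights of \<open>\<xi>\<close> in the direction \<open>\<tau>\<close>, whose
  total mass is zero, until some negative direction exhausts its weight. The exhausted point leaves
  the support, which drives the reduction of supports; the moments change linearly in
  \<open>t\<close>.\<close>

lemma perturb_design:
  fixes \<tau> :: "real \<Rightarrow> real"
  assumes \<xi>: "design A B \<xi>" and T: "finite T" "T \<subseteq> {A..B}"
    and \<tau>: "(\<Sum>x\<in>T. \<tau> x) = 0" "\<exists>x\<in>T. \<tau> x \<noteq> 0" "\<And>x. \<lbrakk>x \<in> T; \<tau> x < 0\<rbrakk> \<Longrightarrow> x \<in> set_pmf \<xi>"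
  obtains t \<zeta> x where "0 < t" "design A B \<zeta>" "set_pmf \<zeta> \<subseteq> set_pmf \<xi> \<union> T"
    "x \<in> set_pmf \<xi>" "x \<notin> set_pmf \<zeta>"
    "\<And>f :: real \<Rightarrow> real.
      measure_pmf.expectation \<zeta> f = measure_pmf.expectation \<xi> f + t * (\<Sum>x\<in>T. \<tau> x * f x)"
proof -
  define N where "N = {x\<in>T. \<tau> x < 0}"
  have "N \<noteq> {}"
  proof
    assume "N = {}"
    then have "\<forall>x\<in>T. 0 \<le> \<tau> x"
      by (auto simp: N_def not_less)
    then show False
      using sum_nonneg_eq_0_iff[OF T(1), of \<tau>] \<tau> by auto
  qed
  moreover have "finite N"
    using T by (simp add: N_def)
  ultimately obtain t x where t: "0 < t" "\<And>x. x \<in> N \<Longrightarrow> t * (- \<tau> x) \<le> pmf \<xi> x"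
    and x: "x \<in> N" "t * (- \<tau> x) = pmf \<xi> x"
    using \<tau>(3) by (elim minimal_ratio_exists[of N "pmf \<xi>" "\<lambda>x. - \<tau> x"]) (auto simp: N_def pmf_positive)
  define S where "S = set_pmf \<xi> \<union> T"
  define W where "W x = pmf \<xi> x + t * (if x \<in> T then \<tau> x else 0)" for x
  have S: "finite S" "S \<subseteq> {A..B}" "set_pmf \<xi> \<subseteq> S" "T \<subseteq> S"
    using \<xi> T by (auto simp: S_def design_def)
  have sum_W: "(\<Sum>x\<in>S. W x * f x) = measure_pmf.expectation \<xi> f + t * (\<Sum>x\<in>T. \<tau> x * f x)" for f
  proof -
    have "(\<Sum>x\<in>S. t * ((if x \<in> T then \<tau> x else 0) * f x)) = t * (\<Sum>x\<in>T. \<tau> x * f x)"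
      unfolding sum_distrib_left using S by (intro sum.mono_neutral_cong_right) auto
    then show ?thesis
      by (simp add: W_def expectation_finite_support[OF S(1,3)] sum.distrib distrib_right mult.assoc)
  qed
  have "0 \<le> W x" for x
    using t(1) t(2)[of x] mult_nonneg_nonneg[of t "\<tau> x"]
    by (cases "x \<in> N") (auto simp: W_def N_def not_less)
  moreover have "(\<Sum>x\<in>S. W x) = 1"
    using sum_W[of "\<lambda>_. 1"] \<tau>(1) by simp
  ultimately obtain \<zeta> where \<zeta>: "set_pmf \<zeta> \<subseteq> S" "\<And>x. x \<in> S \<Longrightarrow> pmf \<zeta> x = W x"
    using pmf_with_weights_exists[OF S(1), of W] by metis
  show thesis
  proof (rule that[OF t(1)])
    show "design A B \<zeta>"
      using \<zeta>(1) S(1,2) by (auto simp: design_def intro: finite_subset)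
    show "set_pmf \<zeta> \<subseteq> set_pmf \<xi> \<union> T"
      using \<zeta>(1) by (simp add: S_def)
    show "x \<in> set_pmf \<xi>"
      using x(1) \<tau>(3) by (auto simp: N_def)
    have "W x = 0"
      using x by (simp add: W_def N_def)
    then show "x \<notin> set_pmf \<zeta>"
      using \<zeta> by (auto simp: set_pmf_iff)
    show "measure_pmf.expectation \<zeta> f = measure_pmf.expectation \<xi> f + t * (\<Sum>x\<in>T. \<tau> x * f x)" for f
      using \<zeta>(2) by (simp add: expectation_finite_support[OF S(1) \<zeta>(1)] sum_W[symmetric])
  qed
qed

text \<open>Gives designs coordinates in a fixed box for the compactness argument. Missing nodes are
  padded by \<open>A\<close> with weight zero.\<close>

lemma design_as_indexed_sum:
  assumes "design A B \<xi>" "card (set_pmf \<xi>) \<le> n" "A \<le> B"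
  obtains x w :: "nat \<Rightarrow> real" where "\<And>i. x i \<in> {A..B}" "\<And>i. w i \<in> {0..1}"
    "\<And>f :: real \<Rightarrow> real. measure_pmf.expectation \<xi> f = (\<Sum>i<n. w i * f (x i))"
proof -
  let ?S = "set_pmf \<xi>"
  have S: "finite ?S" "?S \<subseteq> {A..B}"
    using assms(1) by (auto simp: design_def)
  then obtain h where h: "bij_betw h {..<card ?S} ?S"
    by (metis finite_set_strict_mono_enumeration)
  define x where "x i = (if i < card ?S then h i else A)" for i
  define w where "w i = (if i < card ?S then pmf \<xi> (h i) else 0)" for i
  show thesis
  proof (rule that)
    show "x i \<in> {A..B}" for i
      using bij_betwE[OF h] S(2) \<open>A \<le> B\<close> by (auto simp: x_def)
    show "w i \<in> {0..1}" for i
      by (simp add: w_def pmf_le_1)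
    show "measure_pmf.expectation \<xi> f = (\<Sum>i<n. w i * f (x i))" for f
    proof -
      have "measure_pmf.expectation \<xi> f = (\<Sum>i<card ?S. pmf \<xi> (h i) * f (h i))"
        unfolding expectation_finite_support[OF S(1) order.refl]
        by (rule sum.reindex_bij_betw[OF h, symmetric])
      also have "\<dots> = (\<Sum>i<n. w i * f (x i))"
        using assms(2) by (intro sum.mono_neutral_cong_left) (auto simp: w_def x_def)
      finally show ?thesis .
    qed
  qed
qed

text \<open>The nodes may coincide, so the design is obtained by pushing a distribution on the
  indices forward along \<open>x\<close>, which merges the weights.\<close>

lemma design_from_indexed_sum:
  fixes x w :: "nat \<Rightarrow> real"
  assumes "\<And>i. i < n \<Longrightarrow> x i \<in> {A..B}" "\<And>i. i < n \<Longrightarrow> 0 \<le> w i" "(\<Sum>i<n. w i) = 1"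
  obtains \<xi> where "design A B \<xi>" "\<And>f :: real \<Rightarrow> real. measure_pmf.expectation \<xi> f = (\<Sum>i<n. w i * f (x i))"
proof -
  obtain p where p: "set_pmf p \<subseteq> {..<n}" "\<And>i. i < n \<Longrightarrow> pmf p i = w i"
    using pmf_with_weights_exists[of "{..<n}" w] assms by (metis finite_lessThan lessThan_iff)
  show thesis
  proof
    show "design A B (map_pmf x p)"
      using p(1) assms(1) by (auto simp: design_def intro: finite_subset)
    show "measure_pmf.expectation (map_pmf x p) f = (\<Sum>i<n. w i * f (x i))" for f
      using p(2) by (simp add: expectation_finite_support[OF _ p(1)])
  qed
qed

text \<open>Midpoints are inserted so that the prescribed points occupy the even positions. This
  later places support points of a design where an alternating annihilator is negative.\<close>

lemma interlaced_strict_mono: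
  fixes q :: "nat \<Rightarrow> real"
  assumes q: "strict_mono_on {..m} q"
  shows "strict_mono_on {..2 * m}
    (\<lambda>i. if even i then q (i div 2) else (q (i div 2) + q (Suc (i div 2))) / 2)"
    (is "strict_mono_on _ ?z")
proof (rule strict_mono_onI)
  fix i j assume ij: "i \<in> {..2 * m}" "j \<in> {..2 * m}" "i < j"
  define a b where "a = i div 2" and "b = j div 2"
  have le: "q r \<le> q t" if "r \<le> t" "t \<le> m" for r t
    using that strict_mono_onD[OF q, of r t] by (cases "r = t") auto
  have less: "q r < q t" if "r < t" "t \<le> m" for r t
    using that strict_mono_onD[OF q, of r t] by auto
  have "b \<le> m"
    using ij by (auto simp: b_def)
  have odd_j: "Suc b \<le> m" if "odd j"
    using that ij by (auto simp: b_def elim!: oddE)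
  have zj: "q b \<le> ?z j"
    using le[of b "Suc b"] odd_j by (auto simp: b_def[symmetric])
  show "?z i < ?z j"
  proof (cases "a < b")
    case True
    then have *: "q a < q (Suc a)" "q (Suc a) \<le> q b"
      using less[of a "Suc a"] le[of "Suc a" b] \<open>b \<le> m\<close> by auto
    then have "?z i < q (Suc a)"
      by (auto simp: a_def[symmetric])
    then show ?thesis
      using * zj by linarith
  next
    case False
    then have "a = b"
      using ij by (simp add: a_def b_def div_le_mono order.antisym)
    moreover from this have "even i" "odd j"
      using ij(3) unfolding a_def b_def by presburger+
    ultimately show ?thesis
      using less[of b "Suc b"] odd_j by (simp add: a_def b_def)
  qed
qed

section \<open>Extremal designs for Chebyshev systems\<close>

text \<open>\<open>nondegenerate\<close> is the Chebyshev property, and \<open>leading_sign\<close>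
  orients the system: \<open>s\<close> enters through its sign and stands for a value of
  \<open>F\<close>.\<close>

locale chebyshev_system =
  fixes A B :: real and \<psi> :: "nat \<Rightarrow> real \<Rightarrow> real" and k :: nat and s :: real
  assumes interval: "A < B" and order_pos: "1 \<le> k"
    and const_one: "x \<in> {A..B} \<Longrightarrow> \<psi> 0 x = 1"
    and cont: "j \<le> k \<Longrightarrow> continuous_on {A..B} (\<psi> j)"
    and nondegenerate: "\<lbrakk>strict_mono_on {..k} y; y ` {..k} \<subseteq> {A..B};
      \<And>i. i \<le> k \<Longrightarrow> (\<Sum>j\<le>k. c j * \<psi> j (y i)) = 0; j \<le> k\<rbrakk> \<Longrightarrow> c j = 0"
    and leading_sign: "\<lbrakk>strict_mono_on {..k} y; y ` {..k} \<subseteq> {A..B};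
      \<And>i. i \<le> k \<Longrightarrow> 0 \<le> (-1) ^ (k - i) * (\<Sum>j\<le>k. c j * \<psi> j (y i));
      \<exists>i\<le>k. (\<Sum>j\<le>k. c j * \<psi> j (y i)) \<noteq> 0\<rbrakk> \<Longrightarrow> 0 < c k * s"
begin

section \<open>Interpolation and annihilating weights\<close>

text \<open>Existence follows from uniqueness: appending the column \<open>- v\<close> leaves one
  more unknown than equations, and by \<open>nondegenerate\<close> the coefficient of that column
  cannot vanish, so one may divide by it.\<close>

lemma interpolation:
  assumes y: "strict_mono_on {..k} y" "y ` {..k} \<subseteq> {A..B}"
  obtains c where "\<And>i. i \<le> k \<Longrightarrow> (\<Sum>j\<le>k. c j * \<psi> j (y i)) = v i"
proof -
  define a where "a i j = (if j = Suc k then - v i else \<psi> j (y i))" for i j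
  obtain c where c: "\<exists>j\<le>Suc k. c j \<noteq> 0" "\<And>i. i \<le> k \<Longrightarrow> (\<Sum>j\<le>Suc k. a i j * c j) = 0"
    using homogeneous_system_has_solution[of "{..k}" "{..Suc k}" a] by auto
  have eq: "(\<Sum>j\<le>k. c j * \<psi> j (y i)) = v i * c (Suc k)" if "i \<le> k" for i
    using c(2)[OF that] by (simp add: a_def mult.commute)
  have "c (Suc k) \<noteq> 0"
  proof
    assume 0: "c (Suc k) = 0"
    then have "c j = 0" if "j \<le> k" for j
      using nondegenerate[OF y _ that] eq by simp
    then show False
      using c(1) 0 le_Suc_eq by auto
  qed
  then have "(\<Sum>j\<le>k. c j / c (Suc k) * \<psi> j (y i)) = v i" if "i \<le> k" for i
    using eq[OF that] by (simp add: sum_divide_distrib[symmetric])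
  then show thesis
    by (rule that)
qed

text \<open>Pair \<open>\<sigma>\<close> with the combination that is \<open>(-1) ^ (k - r)\<close>
  at \<open>y r\<close> and zero at the other nodes. Annihilation leaves only its leading
  coefficient times the \<open>\<psi> k\<close> moment of \<open>\<sigma>\<close>, and
  \<open>leading_sign\<close> gives the sign of that coefficient.\<close>

lemma annihilator_alternates:
  assumes y: "strict_mono_on {..k} y" "y ` {..k} \<subseteq> {A..B}"
    and ann: "\<And>j. j < k \<Longrightarrow> (\<Sum>i\<le>k. \<sigma> i * \<psi> j (y i)) = 0" and nz: "\<exists>i\<le>k. \<sigma> i \<noteq> 0" and "i \<le> k"
  shows "0 < (-1) ^ (k - i) * \<sigma> i * s * (\<Sum>i\<le>k. \<sigma> i * \<psi> k (y i))"
proof -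
  define \<tau> where "\<tau> = (\<Sum>i\<le>k. \<sigma> i * \<psi> k (y i))"
  have coeff: "\<exists>c. (-1) ^ (k - r) * \<sigma> r = c * \<tau> \<and> 0 < c * s" if "r \<le> k" for r
  proof -
    obtain c where c: "\<And>i. i \<le> k \<Longrightarrow>
        (\<Sum>j\<le>k. c j * \<psi> j (y i)) = (if i = r then (-1) ^ (k - r) else 0)"
      using interpolation[OF y, of "\<lambda>i. if i = r then (-1) ^ (k - r) else 0"] by blast
    have "0 < c k * s"
      using that by (intro leading_sign[OF y]) (auto simp: c simp flip: power_add)
    have "(-1) ^ (k - r) * \<sigma> r = (\<Sum>i\<le>k. \<sigma> i * (\<Sum>j\<le>k. c j * \<psi> j (y i)))"
      using that by (simp add: c if_distrib[of "(*) _"] mult.commute cong: if_cong)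
    also have "\<dots> = (\<Sum>j\<le>k. c j * (\<Sum>i\<le>k. \<sigma> i * \<psi> j (y i)))"
      unfolding sum_distrib_left by (subst sum.swap) (simp add: mult_ac)
    also have "\<dots> = (\<Sum>j\<in>{k}. c j * (\<Sum>i\<le>k. \<sigma> i * \<psi> j (y i)))"
      by (intro sum.mono_neutral_right) (auto simp: ann order_less_le)
    finally show ?thesis
      using \<open>0 < c k * s\<close> by (auto simp: \<tau>_def)
  qed
  obtain r where "r \<le> k" "\<sigma> r \<noteq> 0"
    using nz by blast
  then have "\<tau> \<noteq> 0"
    using coeff[of r] by auto
  obtain c where c: "(-1) ^ (k - i) * \<sigma> i = c * \<tau>" "0 < c * s"
    using coeff[OF \<open>i \<le> k\<close>] by blast
  then have "(-1) ^ (k - i) * \<sigma> i * s * \<tau> = c * s * \<tau>\<^sup>2"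
    by (simp add: power2_eq_square)
  also have "\<dots> > 0"
    using c(2) \<open>\<tau> \<noteq> 0\<close> by simp
  finally show ?thesis
    by (simp add: \<tau>_def)
qed

lemma annihilator_exists:
  assumes "finite T" "card T = Suc k"
  obtains \<tau> where "\<exists>x\<in>T. \<tau> x \<noteq> 0" "\<And>j. j < k \<Longrightarrow> (\<Sum>x\<in>T. \<tau> x * \<psi> j x) = 0"
  using homogeneous_system_has_solution[of "{..<k}" T \<psi>] assms by (auto simp: mult.commute)

text \<open>Caratheodory reduction: while more than \<open>k + 1\<close> points remain, perturbing
  along an annihilator on \<open>k + 1\<close> of them removes a support point.\<close>

lemma reduce_support:
  assumes "design A B \<xi>"
  obtains \<zeta> where "design A B \<zeta>" "card (set_pmf \<zeta>) \<le> Suc k"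
    "\<And>j. j < k \<Longrightarrow> measure_pmf.expectation \<zeta> (\<psi> j) = measure_pmf.expectation \<xi> (\<psi> j)"
    "measure_pmf.expectation \<xi> (\<psi> k) \<le> measure_pmf.expectation \<zeta> (\<psi> k)"
  using assms
proof (induction "card (set_pmf \<xi>)" arbitrary: \<xi> thesis rule: less_induct)
  case less
  show ?case
  proof (cases "card (set_pmf \<xi>) \<le> Suc k")
    case True
    then show ?thesis
      using less.prems by blast
  next
    case False
    then obtain T where T: "T \<subseteq> set_pmf \<xi>" "card T = Suc k" "finite T"
      using obtain_subset_with_card_n[of "Suc k" "set_pmf \<xi>"] by auto
    have TAB: "T \<subseteq> {A..B}"
      using T less.prems(2) by (auto simp: design_def)
    obtain \<tau>' where \<tau>': "\<exists>x\<in>T. \<tau>' x \<noteq> 0" "\<And>j. j < k \<Longrightarrow> (\<Sum>x\<in>T. \<tau>' x * \<psi> j x) = 0"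
      using annihilator_exists T by blast
    \<comment> \<open>The orientation of the annihilator is chosen so that the
      \<open>\<psi> k\<close> moment does not decrease.\<close>
    define \<epsilon> :: real where "\<epsilon> = (if 0 \<le> (\<Sum>x\<in>T. \<tau>' x * \<psi> k x) then 1 else -1)"
    define \<tau> where "\<tau> x = \<epsilon> * \<tau>' x" for x
    have sum_\<tau>: "(\<Sum>x\<in>T. \<tau> x * \<psi> j x) = \<epsilon> * (\<Sum>x\<in>T. \<tau>' x * \<psi> j x)" for j
      by (simp add: \<tau>_def sum_distrib_left mult.assoc)
    have \<tau>: "\<exists>x\<in>T. \<tau> x \<noteq> 0" "\<And>j. j < k \<Longrightarrow> (\<Sum>x\<in>T. \<tau> x * \<psi> j x) = 0"
      "0 \<le> (\<Sum>x\<in>T. \<tau> x * \<psi> k x)"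
    proof -
      show "\<exists>x\<in>T. \<tau> x \<noteq> 0"
        using \<tau>'(1) by (auto simp: \<tau>_def \<epsilon>_def)
    qed (simp_all add: sum_\<tau> \<tau>'(2), simp add: \<epsilon>_def)
    have "(\<Sum>x\<in>T. \<tau> x) = (\<Sum>x\<in>T. \<tau> x * \<psi> 0 x)"
      using TAB by (intro sum.cong) (auto simp: const_one)
    then have "(\<Sum>x\<in>T. \<tau> x) = 0"
      using \<tau>(2)[of 0] order_pos by simp
    then obtain t \<zeta> x where \<zeta>: "0 < t" "design A B \<zeta>" "set_pmf \<zeta> \<subseteq> set_pmf \<xi> \<union> T"
      "x \<in> set_pmf \<xi>" "x \<notin> set_pmf \<zeta>"
      and e: "\<And>f. measure_pmf.expectation \<zeta> f =
        measure_pmf.expectation \<xi> f + t * (\<Sum>x\<in>T. \<tau> x * f x)"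
      using perturb_design[OF less.prems(2) T(3) TAB _ \<tau>(1)] T(1) by blast
    have "set_pmf \<zeta> \<subset> set_pmf \<xi>"
      using \<zeta> T(1) by auto
    then have "card (set_pmf \<zeta>) < card (set_pmf \<xi>)"
      using less.prems(2) by (intro psubset_card_mono) (auto simp: design_def)
    then show ?thesis
    proof (rule less.hyps[OF _ _ \<zeta>(2)])
      fix \<zeta>' assume \<zeta>': "design A B \<zeta>'" "card (set_pmf \<zeta>') \<le> Suc k"
        "\<And>j. j < k \<Longrightarrow> measure_pmf.expectation \<zeta>' (\<psi> j) = measure_pmf.expectation \<zeta> (\<psi> j)"
        "measure_pmf.expectation \<zeta> (\<psi> k) \<le> measure_pmf.expectation \<zeta>' (\<psi> k)"
      show ?thesis
      proof (rule less.prems(1)[OF \<zeta>'(1,2)])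
        show "measure_pmf.expectation \<zeta>' (\<psi> j) = measure_pmf.expectation \<xi> (\<psi> j)" if "j < k" for j
          using \<zeta>'(3)[OF that] e[of "\<psi> j"] \<tau>(2)[OF that] by simp
        have "0 \<le> t * (\<Sum>x\<in>T. \<tau> x * \<psi> k x)"
          using \<zeta>(1) \<tau>(3) by simp
        then show "measure_pmf.expectation \<xi> (\<psi> k) \<le> measure_pmf.expectation \<zeta>' (\<psi> k)"
          using \<zeta>'(4) e[of "\<psi> k"] by linarith
      qed
    qed
  qed
qed

text \<open>Conformal reduction: subtracting an annihilator supported on \<open>k + 1\<close> points shrinks the
  support without changing signs, down to \<open>k + 1\<close> points, where the signs alternate.\<close>

lemma annihilator_sign_changes:
  assumes "finite S" "S \<subseteq> {A..B}" "\<exists>x\<in>S. \<sigma> x \<noteq> 0"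
    "\<And>j. j < k \<Longrightarrow> (\<Sum>x\<in>S. \<sigma> x * \<psi> j x) = 0"
  shows "\<exists>y e. strict_mono_on {..k} y \<and> y ` {..k} \<subseteq> S \<and> (\<forall>i\<le>k. 0 < (-1) ^ i * \<sigma> (y i) * e)"
  using assms(3,4)
proof (induction "card {x\<in>S. \<sigma> x \<noteq> 0}" arbitrary: \<sigma> rule: less_induct)
  case less
  define S0 where "S0 = {x\<in>S. \<sigma> x \<noteq> 0}"
  have S0: "finite S0" "S0 \<subseteq> {A..B}" "S0 \<subseteq> S"
    using assms(1,2) by (auto simp: S0_def)
  show ?case
  proof (cases "card S0 \<le> Suc k")
    case True
    have "infinite {A..B}"
      using interval by (simp add: infinite_Icc)
    then have "infinite ({A..B} - S0)"
      using S0(1) by simp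
    \<comment> \<open>Pads the support to \<open>k + 1\<close> nodes by points of weight zero.
      Alternation then shows that all the weights are nonzero, so all nodes lie in
      \<open>S\<close>.\<close>
    then obtain R where R: "R \<subseteq> {A..B} - S0" "card R = Suc k - card S0" "finite R"
      using infinite_arbitrarily_large by blast
    define T where "T = S0 \<union> R"
    have "card T = card S0 + card R"
      unfolding T_def using S0 R by (intro card_Un_disjoint) auto
    then have T: "finite T" "T \<subseteq> {A..B}" "S0 \<subseteq> T" "card T = Suc k"
      using S0 R True by (auto simp: T_def)
    obtain y where y: "bij_betw y {..k} T" "strict_mono_on {..k} y"
      using finite_set_strict_mono_enumeration[OF T(1)] unfolding T(4) lessThan_Suc_atMost by blast
    have yT: "y ` {..k} = T"
      using y(1) by (simp add: bij_betw_def)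
    define \<sigma>0 where "\<sigma>0 x = (if x \<in> S then \<sigma> x else 0)" for x
    have reindex: "(\<Sum>i\<le>k. \<sigma>0 (y i) * \<psi> j (y i)) = (\<Sum>x\<in>S. \<sigma> x * \<psi> j x)" for j
    proof -
      have "(\<Sum>i\<le>k. \<sigma>0 (y i) * \<psi> j (y i)) = (\<Sum>x\<in>T. \<sigma>0 x * \<psi> j x)"
        by (rule sum.reindex_bij_betw[OF y(1)])
      also have "\<dots> = (\<Sum>x\<in>S0. \<sigma> x * \<psi> j x)"
        using T by (intro sum.mono_neutral_cong_right) (auto simp: \<sigma>0_def S0_def)
      also have "\<dots> = (\<Sum>x\<in>S. \<sigma> x * \<psi> j x)"
        using assms(1) by (intro sum.mono_neutral_left) (auto simp: S0_def)
      finally show ?thesis .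
    qed
    obtain x where "x \<in> S" "\<sigma> x \<noteq> 0"
      using less.prems(1) by blast
    moreover from this obtain r where "r \<le> k" "y r = x"
      using T(3) yT by (force simp: S0_def)
    ultimately have nz: "\<exists>i\<le>k. \<sigma>0 (y i) \<noteq> 0"
      by (auto simp: \<sigma>0_def)
    define e where "e = (-1) ^ k * s * (\<Sum>i\<le>k. \<sigma>0 (y i) * \<psi> k (y i))"
    have pos: "0 < (-1) ^ i * \<sigma>0 (y i) * e" if "i \<le> k" for i
    proof -
      have "(-1::real) ^ (k - i) = (-1) ^ i * (-1) ^ k"
        using that by (simp add: power_diff power_mult_distrib[symmetric] divide_simps)
      then show ?thesis
        using annihilator_alternates[OF y(2) _ _ nz that] yT T(2) less.prems(2)
        by (simp add: reindex e_def mult_ac)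
    qed
    then have "y i \<in> S \<and> \<sigma>0 (y i) = \<sigma> (y i)" if "i \<le> k" for i
      using that by (force simp: \<sigma>0_def split: if_splits)
    then show ?thesis
      using y(2) pos by (intro exI[of _ y] exI[of _ e]) auto
  next
    case False
    then obtain T where T: "T \<subseteq> S0" "card T = Suc k" "finite T"
      using obtain_subset_with_card_n[of "Suc k" S0] by auto
    obtain \<tau>' where \<tau>': "\<exists>x\<in>T. \<tau>' x \<noteq> 0" "\<And>j. j < k \<Longrightarrow> (\<Sum>x\<in>T. \<tau>' x * \<psi> j x) = 0"
      using annihilator_exists T by blast
    then obtain p where p: "p \<in> T" "\<tau>' p \<noteq> 0"
      by blast
    \<comment> \<open>The factor \<open>\<sigma> p * \<tau>' p\<close> makes \<open>\<tau>\<close>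
      agree in sign with \<open>\<sigma>\<close> at \<open>p\<close>, so that \<open>N\<close> is
      nonempty.\<close>
    define \<tau> where "\<tau> x = (if x \<in> T then \<sigma> p * \<tau>' p * \<tau>' x else 0)" for x
    have \<tau>: "(\<Sum>x\<in>S. \<tau> x * \<psi> j x) = 0" if "j < k" for j
    proof -
      have "(\<Sum>x\<in>S. \<tau> x * \<psi> j x) = (\<Sum>x\<in>T. \<sigma> p * \<tau>' p * (\<tau>' x * \<psi> j x))"
        using T(1) S0(3) assms(1) by (intro sum.mono_neutral_cong_right) (auto simp: \<tau>_def)
      also have "\<dots> = 0"
        using \<tau>'(2)[OF that] by (simp add: sum_distrib_left[symmetric])
      finally show ?thesis .
    qed
    define N where "N = {x\<in>T. 0 < \<sigma> x * \<tau> x}"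
    have "\<sigma> p \<noteq> 0"
      using p(1) T(1) by (auto simp: S0_def)
    have "\<sigma> p * \<tau> p = (\<sigma> p)\<^sup>2 * (\<tau>' p)\<^sup>2"
      using p(1) by (simp add: \<tau>_def power2_eq_square)
    then have "p \<in> N"
      using p \<open>\<sigma> p \<noteq> 0\<close> by (simp add: N_def)
    \<comment> \<open>The largest step for which \<open>\<sigma> - t * \<tau>\<close> nowhere has
      the sign opposite to \<open>\<sigma>\<close>; both sides are multiplied by
      \<open>\<sigma> x\<close> to treat the two signs at once.\<close>
    then obtain t x where t: "0 < t" "\<And>x. x \<in> N \<Longrightarrow> t * (\<sigma> x * \<tau> x) \<le> (\<sigma> x)\<^sup>2"
      and x: "x \<in> N" "t * (\<sigma> x * \<tau> x) = (\<sigma> x)\<^sup>2"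
      using T(3) by (elim minimal_ratio_exists[of N "\<lambda>x. (\<sigma> x)\<^sup>2" "\<lambda>x. \<sigma> x * \<tau> x", rotated 4])
        (auto simp: N_def)
    define \<sigma>' where "\<sigma>' z = \<sigma> z - t * \<tau> z" for z
    have conformal: "0 \<le> \<sigma>' z * \<sigma> z" for z
    proof (cases "z \<in> N")
      case True
      then show ?thesis
        using t(2)[of z] by (simp add: \<sigma>'_def power2_eq_square algebra_simps)
    next
      case False
      then have "\<sigma> z * \<tau> z \<le> 0"
        by (auto simp: N_def \<tau>_def not_less)
      then have "t * (\<sigma> z * \<tau> z) \<le> 0"
        using t(1) by (simp add: mult_nonneg_nonpos)
      moreover have "\<sigma>' z * \<sigma> z = (\<sigma> z)\<^sup>2 - t * (\<sigma> z * \<tau> z)"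
        by (simp add: \<sigma>'_def power2_eq_square algebra_simps)
      ultimately show ?thesis
        by (smt (verit) zero_le_power2)
    qed
    have supp: "\<sigma> z \<noteq> 0" if "z \<in> S" "\<sigma>' z \<noteq> 0" for z
      using that T(1) by (auto simp: \<sigma>'_def \<tau>_def S0_def split: if_splits)
    have "\<sigma> x \<noteq> 0" "x \<in> S"
      using x(1) T(1) S0(3) by (auto simp: N_def)
    moreover from this have "\<sigma>' x = 0"
      using x(2) by (simp add: \<sigma>'_def power2_eq_square)
    ultimately have "{z\<in>S. \<sigma>' z \<noteq> 0} \<subset> {z\<in>S. \<sigma> z \<noteq> 0}"
      using supp by blast
    then have "card {z\<in>S. \<sigma>' z \<noteq> 0} < card {z\<in>S. \<sigma> z \<noteq> 0}"
      using assms(1) by (intro psubset_card_mono) auto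
    moreover have "\<exists>z\<in>S. \<sigma>' z \<noteq> 0"
    proof -
      \<comment> \<open>A point of \<open>S0\<close> outside \<open>T\<close> keeps its weight, so
        the reduced weights do not vanish identically.\<close>
      have "\<not> S0 \<subseteq> T"
        using False T(2,3) card_mono by metis
      then show ?thesis
        by (auto simp: S0_def \<sigma>'_def \<tau>_def)
    qed
    moreover have "(\<Sum>z\<in>S. \<sigma>' z * \<psi> j z) = 0" if "j < k" for j
    proof -
      have "(\<Sum>z\<in>S. \<sigma>' z * \<psi> j z) = (\<Sum>z\<in>S. \<sigma> z * \<psi> j z) - t * (\<Sum>z\<in>S. \<tau> z * \<psi> j z)"
        by (simp add: \<sigma>'_def left_diff_distrib sum_subtractf sum_distrib_left mult.assoc)
      then show ?thesis
        using less.prems(2)[OF that] \<tau>[OF that] by simp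
    qed
    ultimately obtain y e where ye: "strict_mono_on {..k} y" "y ` {..k} \<subseteq> S"
      "\<forall>i\<le>k. 0 < (-1) ^ i * \<sigma>' (y i) * e"
      using less.hyps[of \<sigma>'] by blast
    have "0 < (-1) ^ i * \<sigma> (y i) * e" if "i \<le> k" for i
    proof -
      have pos: "0 < (-1) ^ i * \<sigma>' (y i) * e"
        using ye(3) that by blast
      then have "\<sigma>' (y i) \<noteq> 0"
        by auto
      then have "\<sigma> (y i) \<noteq> 0"
        using supp ye(2) that by auto
      then have "0 < \<sigma>' (y i) * \<sigma> (y i)"
        using \<open>\<sigma>' (y i) \<noteq> 0\<close> conformal[of "y i"] by (simp add: order_less_le)
      then show ?thesis
        using pos by (auto simp: zero_less_mult_iff mult_less_0_iff)
    qed
    then show ?thesis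
      using ye(1,2) by blast
  qed
qed

text \<open>The endpoints that cannot carry a negative weight in an annihilator on \<open>k + 1\<close> points whose
  negative weights sit at the positions of the same parity as \<open>d\<close>.\<close>

definition avoided :: "nat \<Rightarrow> real set" where
  "avoided d = (if d = 1 then {A} else {}) \<union> (if odd (k + d) then {B} else {})"

section \<open>Comparing and improving designs with prescribed moments\<close>

text \<open>The difference of the weights is an annihilator, so it alternates on
  \<open>k + 1\<close> points. Where it is negative, \<open>\<xi>\<close> has mass; these are the
  positions of one parity \<open>d\<close>, and there are \<open>(k + 2 - d) div 2\<close> of them
  among \<open>0, ..., k\<close>.\<close>

lemma different_design_same_moments:
  assumes \<xi>: "design A B \<xi>" and \<zeta>: "design A B \<zeta>" "\<zeta> \<noteq> \<xi>"
    and same: "\<And>j. j < k \<Longrightarrow> measure_pmf.expectation \<zeta> (\<psi> j) = measure_pmf.expectation \<xi> (\<psi> j)"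
  shows "\<exists>d\<le>1. (k + 2 - d) div 2 \<le> card (set_pmf \<xi> - avoided d)"
proof -
  define S where "S = set_pmf \<xi> \<union> set_pmf \<zeta>"
  have S: "finite S" "S \<subseteq> {A..B}" "set_pmf \<xi> \<subseteq> S" "set_pmf \<zeta> \<subseteq> S"
    using \<xi> \<zeta> by (auto simp: S_def design_def)
  define \<sigma> where "\<sigma> x = pmf \<zeta> x - pmf \<xi> x" for x
  have "\<exists>x\<in>S. \<sigma> x \<noteq> 0"
  proof (rule ccontr)
    assume "\<not> (\<exists>x\<in>S. \<sigma> x \<noteq> 0)"
    then have "pmf \<zeta> x = pmf \<xi> x" for x
      by (cases "x \<in> S") (auto simp: \<sigma>_def S_def set_pmf_iff)
    then show False
      using \<zeta>(2) by (auto intro: pmf_eqI)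
  qed
  moreover have "(\<Sum>x\<in>S. \<sigma> x * \<psi> j x) = 0" if "j < k" for j
    using same[OF that]
    by (simp add: \<sigma>_def left_diff_distrib sum_subtractf expectation_finite_support[OF S(1,3)]
        expectation_finite_support[OF S(1,4)])
  ultimately obtain y e where y: "strict_mono_on {..k} y" "y ` {..k} \<subseteq> S"
    "\<And>i. i \<le> k \<Longrightarrow> 0 < (-1) ^ i * \<sigma> (y i) * e"
    using annihilator_sign_changes[OF S(1,2), of \<sigma>] by blast
  \<comment> \<open>The parity of the positions at which the difference is negative.\<close>
  define d :: nat where "d = (if 0 < e then 1 else 0)"
  have yAB: "A \<le> y i" "y i \<le> B" if "i \<le> k" for i
    using y(2) S(2) that by fastforce+
  have mem: "y i \<in> set_pmf \<xi> - avoided d" if i: "i \<le> k" "even (i + d)" for i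
  proof -
    have "\<sigma> (y i) < 0"
    proof (cases "0 < e")
      case True
      then have "odd i"
        using i(2) by (simp add: d_def)
      then show ?thesis
        using y(3)[OF i(1)] True by (simp add: mult_less_0_iff)
    next
      case False
      then have "even i"
        using i(2) by (simp add: d_def)
      then show ?thesis
        using y(3)[OF i(1)] False by (simp add: zero_less_mult_iff)
    qed
    then have "y i \<in> set_pmf \<xi>"
      using pmf_nonneg[of \<zeta> "y i"] by (auto simp: \<sigma>_def set_pmf_iff)
    moreover have "y i \<noteq> A" if "d = 1"
    proof -
      have "0 < i"
        using that i(2) by (cases i) auto
      then have "y 0 < y i"
        using y(1) i(1) by (auto simp: strict_mono_on_def)
      then show ?thesis
        using yAB(1)[of 0] by simp
    qed
    moreover have "y i \<noteq> B" if "odd (k + d)"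
    proof -
      have "i < k"
        using that i by (cases "i = k") auto
      then have "y i < y k"
        using y(1) by (auto simp: strict_mono_on_def)
      then show ?thesis
        using yAB(2)[of k] by simp
    qed
    ultimately show ?thesis
      by (auto simp: avoided_def)
  qed
  have le_k: "2 * j + d \<le> k" if "j < (k + 2 - d) div 2" for j
    using that order_pos by (auto simp: d_def split: if_splits)
  have "card {..<(k + 2 - d) div 2} \<le> card (set_pmf \<xi> - avoided d)"
  proof (rule card_inj_on_le[where f = "\<lambda>j. y (2 * j + d)"])
    show "inj_on (\<lambda>j. y (2 * j + d)) {..<(k + 2 - d) div 2}"
      using le_k by (intro inj_onI) (auto dest!: inj_onD[OF strict_mono_on_imp_inj_on[OF y(1)]])
    show "(\<lambda>j. y (2 * j + d)) ` {..<(k + 2 - d) div 2} \<subseteq> set_pmf \<xi> - avoided d"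
      using mem le_k by auto
    show "finite (set_pmf \<xi> - avoided d)"
      using S by (auto intro: finite_subset)
  qed
  then show ?thesis
    by (intro exI[of _ d]) (auto simp: d_def)
qed

text \<open>Nodes are laid out so that every position of parity \<open>d\<close> is a support point
  of \<open>\<xi>\<close>. The sign of \<open>s\<close> then allows an annihilator with increasing
  \<open>\<psi> k\<close> moment whose negative weights sit only there.\<close>

lemma improvable_design:
  assumes \<xi>: "design A B \<xi>" and d: "d \<le> 1" "odd (k + d) \<longleftrightarrow> 0 < s"
    and large: "(k + 2 - d) div 2 \<le> card (set_pmf \<xi> - avoided d)"
  shows "\<exists>\<zeta>. design A B \<zeta> \<and>
    (\<forall>j<k. measure_pmf.expectation \<zeta> (\<psi> j) = measure_pmf.expectation \<xi> (\<psi> j)) \<and>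
    measure_pmf.expectation \<xi> (\<psi> k) < measure_pmf.expectation \<zeta> (\<psi> k)"
proof -
  obtain X where X: "X \<subseteq> set_pmf \<xi> - avoided d" "card X = (k + 2 - d) div 2" "finite X"
    using obtain_subset_with_card_n[OF large] by blast
  \<comment> \<open>The avoided endpoints act as sentinels: they become the first or last entry of
    \<open>q\<close>, and the nodes \<open>y\<close> begin or end at the midpoint next to
    them.\<close>
  define Q where "Q = X \<union> avoided d"
  have fin: "finite (avoided d)" "finite Q"
    using X by (auto simp: Q_def avoided_def)
  have card_avoided: "card (avoided d) = of_bool (d = 1) + of_bool (odd (k + d))"
    using interval by (auto simp: avoided_def)
  have "card Q = card X + card (avoided d)"
    unfolding Q_def using X fin by (intro card_Un_disjoint) auto
  \<comment> \<open>Interlacing \<open>Q\<close> gives \<open>2 * m + 1\<close> entries. Dropping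
    the first one if \<open>d = 1\<close> and the last one if \<open>k + d\<close> is odd leaves
    exactly \<open>k + 1\<close> nodes.\<close>
  define m where "m = card Q - 1"
  have m: "card Q = Suc m" "2 * m = k + d + of_bool (odd (k + d))"
    using \<open>card Q = _\<close> X(2) d(1) order_pos unfolding card_avoided m_def
    by (cases "d = 0"; cases "even k"; auto elim!: evenE oddE)+
  have QAB: "Q \<subseteq> {A..B}"
    using X(1) \<xi> interval by (auto simp: Q_def design_def avoided_def)
  obtain q where q: "bij_betw q {..m} Q" "strict_mono_on {..m} q"
    using finite_set_strict_mono_enumeration[OF fin(2)] unfolding m(1) lessThan_Suc_atMost by blast
  have qQ: "q r \<in> Q" if "r \<le> m" for r
    using q(1) that by (auto simp: bij_betw_def)
  then have qAB: "A \<le> q r" "q r \<le> B" if "r \<le> m" for r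
    using QAB that by fastforce+
  define z where "z i = (if even i then q (i div 2) else (q (i div 2) + q (Suc (i div 2))) / 2)" for i
  have z: "strict_mono_on {..2 * m} z"
    unfolding z_def by (rule interlaced_strict_mono[OF q(2)])
  define y where "y i = z (i + d)" for i
  have le_2m: "i + d \<le> 2 * m" if "i \<le> k" for i
    using m(2) that by simp
  have y: "strict_mono_on {..k} y"
    using z le_2m by (auto simp: strict_mono_on_def y_def)
  have yAB: "y i \<in> {A..B}" if "i \<le> k" for i
  proof -
    define r where "r = (i + d) div 2"
    have "r \<le> m" "odd (i + d) \<Longrightarrow> Suc r \<le> m"
      using le_2m[OF that] by (auto simp: r_def elim!: oddE)
    then show ?thesis
      using qAB[of r] qAB[of "Suc r"] by (auto simp: y_def z_def r_def[symmetric])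
  qed
  have y_mem: "y i \<in> set_pmf \<xi>" if "i \<le> k" "even (i + d)" for i
  proof -
    define r where "r = (i + d) div 2"
    have i: "i + d = 2 * r"
      using that(2) by (simp add: r_def)
    then have "r \<le> m"
      using le_2m[OF that(1)] by simp
    have "q r \<notin> avoided d"
    proof
      assume "q r \<in> avoided d"
      then consider "d = 1" "q r = A" | "odd (k + d)" "q r = B"
        by (auto simp: avoided_def split: if_splits)
      then show False
      proof cases
        case 1
        then have "q 0 < q r"
          using q(2) i \<open>r \<le> m\<close> by (auto simp: strict_mono_on_def)
        then show False
          using 1 qAB(1)[of 0] by simp
      next
        case 2
        then have "r < m"
          using m(2) i that(1) by auto
        then have "q r < q m"
          using q(2) by (auto simp: strict_mono_on_def)
        then show False
          using 2 qAB(2)[of m] by simp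
      qed
    qed
    then have "q r \<in> set_pmf \<xi>"
      using qQ[OF \<open>r \<le> m\<close>] X(1) by (auto simp: Q_def)
    then show ?thesis
      using i by (simp add: y_def z_def)
  qed
  define T where "T = y ` {..k}"
  have inj: "inj_on y {..k}"
    using y by (rule strict_mono_on_imp_inj_on)
  have T: "finite T" "T \<subseteq> {A..B}" "card T = Suc k"
    using yAB inj by (auto simp: T_def card_image)
  obtain \<tau> where \<tau>: "\<exists>x\<in>T. \<tau> x \<noteq> 0" "\<And>j. j < k \<Longrightarrow> (\<Sum>x\<in>T. \<tau> x * \<psi> j x) = 0"
    using annihilator_exists[OF T(1,3)] by blast
  have reindex: "(\<Sum>i\<le>k. \<tau> (y i) * \<psi> j (y i)) = (\<Sum>x\<in>T. \<tau> x * \<psi> j x)" for j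
    unfolding T_def by (simp add: sum.reindex[OF inj])
  define \<mu> where "\<mu> = (\<Sum>x\<in>T. \<tau> x * \<psi> k x)"
  have alt: "0 < (-1) ^ (k - i) * \<tau> (y i) * s * \<mu>" if "i \<le> k" for i
    using annihilator_alternates[OF y _ _ _ that, of "\<lambda>i. \<tau> (y i)"] T(2) \<tau>
    by (force simp: T_def reindex \<mu>_def)
  then have "\<mu> \<noteq> 0"
    using alt[of 0] by auto
  \<comment> \<open>Scaling by \<open>\<mu>\<close> turns the \<open>\<psi> k\<close> moment of the
    annihilator into the positive number \<open>\<mu> * \<mu>\<close>, whatever its original
    orientation.\<close>
  define \<sigma> where "\<sigma> x = \<mu> * \<tau> x" for x
  have \<sigma>_sum: "(\<Sum>x\<in>T. \<sigma> x * f x) = \<mu> * (\<Sum>x\<in>T. \<tau> x * f x)" for f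
    by (simp add: \<sigma>_def sum_distrib_left mult.assoc)
  have "(\<Sum>x\<in>T. \<sigma> x) = (\<Sum>x\<in>T. \<sigma> x * \<psi> 0 x)"
    using T(2) by (intro sum.cong) (auto simp: const_one)
  then have \<sigma>0: "(\<Sum>x\<in>T. \<sigma> x) = 0"
    using \<tau>(2)[of 0] order_pos by (simp add: \<sigma>_sum)
  have \<sigma>_nz: "\<exists>x\<in>T. \<sigma> x \<noteq> 0"
    using \<tau>(1) \<open>\<mu> \<noteq> 0\<close> by (auto simp: \<sigma>_def)
  have neg: "x \<in> set_pmf \<xi>" if xT: "x \<in> T" and "\<sigma> x < 0" for x
  proof -
    obtain i where i: "i \<le> k" "x = y i"
      using xT by (auto simp: T_def)
    \<comment> \<open>The alternation fixes the sign of each weight through \<open>s\<close> and the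
      distance to the last node; the condition on \<open>d\<close> translates negativity into
      \<open>even (i + d)\<close>.\<close>
    have "0 < ((-1) ^ (k - i) * s) * \<sigma> x"
      using alt[OF i(1)] unfolding i(2) \<sigma>_def by (simp only: mult_ac)
    then have "(-1) ^ (k - i) * s < 0"
      using \<open>\<sigma> x < 0\<close> by (metis not_less_iff_gr_or_eq zero_less_mult_iff)
    then have "even (k - i) \<longleftrightarrow> s < 0" "s \<noteq> 0"
      by (cases "even (k - i)"; simp)+
    then have "even (i + d)"
      using d(2) i(1) by (cases "s < 0") auto
    then show ?thesis
      using y_mem i by blast
  qed
  show ?thesis
  proof (rule perturb_design[OF \<xi> T(1,2) \<sigma>0 \<sigma>_nz neg])
    fix t \<zeta>
    assume t: "0 < t" and \<zeta>: "design A B \<zeta>"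
      and e: "\<And>f :: real \<Rightarrow> real.
        measure_pmf.expectation \<zeta> f = measure_pmf.expectation \<xi> f + t * (\<Sum>x\<in>T. \<sigma> x * f x)"
    have "0 < \<mu> * \<mu>"
      using \<open>\<mu> \<noteq> 0\<close> not_real_square_gt_zero by blast
    then have "0 < t * (\<mu> * \<mu>)"
      by (rule mult_pos_pos[OF t])
    then have "measure_pmf.expectation \<xi> (\<psi> k) < measure_pmf.expectation \<zeta> (\<psi> k)"
      unfolding e[of "\<psi> k"] \<sigma>_sum \<mu>_def[symmetric] by simp
    moreover have "measure_pmf.expectation \<zeta> (\<psi> j) = measure_pmf.expectation \<xi> (\<psi> j)" if "j < k" for j
      unfolding e[of "\<psi> j"] \<sigma>_sum \<tau>(2)[OF that] by simp
    ultimately show ?thesis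
      using \<zeta> by blast
  qed
qed

section \<open>Existence of a design with maximal last moment\<close>

text \<open>Designs with at most \<open>k + 1\<close> points suffice by
  \<open>reduce_support\<close>. In node and weight coordinates they form a compact set, cut out of
  a box by continuous moment conditions.\<close>

lemma maximizing_design_exists:
  assumes "design A B \<xi>"
  obtains \<xi>' where "design A B \<xi>'"
    "\<And>j. j < k \<Longrightarrow> measure_pmf.expectation \<xi>' (\<psi> j) = measure_pmf.expectation \<xi> (\<psi> j)"
    "\<And>\<zeta>. \<lbrakk>design A B \<zeta>;
        \<And>j. j < k \<Longrightarrow> measure_pmf.expectation \<zeta> (\<psi> j) = measure_pmf.expectation \<xi> (\<psi> j)\<rbrakk>
      \<Longrightarrow> measure_pmf.expectation \<zeta> (\<psi> k) \<le> measure_pmf.expectation \<xi>' (\<psi> k)"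
proof -
  \<comment> \<open>Clamping the nodes to \<open>{A..B}\<close> makes the moments continuous on the
    whole coordinate space, although \<open>\<psi> j\<close> is controlled only on the
    interval.\<close>
  define mom :: "nat \<Rightarrow> (nat \<Rightarrow> real) \<times> (nat \<Rightarrow> real) \<Rightarrow> real" where
    "mom j z = (\<Sum>i<Suc k. snd z i * \<psi> j (max A (min B (fst z i))))" for j z
  have mom: "mom j z = (\<Sum>i<Suc k. snd z i * \<psi> j (fst z i))" if "\<And>i. fst z i \<in> {A..B}" for j z
  proof -
    have "max A (min B (fst z i)) = fst z i" for i
      using that[of i] by auto
    then show ?thesis
      by (simp only: mom_def)
  qed
  have cont_mom: "continuous_on UNIV (mom j)" if "j \<le> k" for j
  proof -
    have coord: "continuous_on UNIV (\<lambda>z::(nat \<Rightarrow> real) \<times> (nat \<Rightarrow> real). fst z i)"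
      "continuous_on UNIV (\<lambda>z::(nat \<Rightarrow> real) \<times> (nat \<Rightarrow> real). snd z i)" for i
      by (rule continuous_on_product_then_coordinatewise, intro continuous_intros)+
    have "continuous_on UNIV (\<lambda>z::(nat \<Rightarrow> real) \<times> (nat \<Rightarrow> real). \<psi> j (max A (min B (fst z i))))" for i
      using interval by (intro continuous_on_compose2[OF cont[OF that]] continuous_on_max
          continuous_on_min continuous_on_const coord) auto
    then show ?thesis
      unfolding mom_def by (intro continuous_on_sum continuous_on_mult coord)
  qed
  define box :: "((nat \<Rightarrow> real) \<times> (nat \<Rightarrow> real)) set" where
    "box = PiE UNIV (\<lambda>_. {A..B}) \<times> PiE UNIV (\<lambda>_. {0..1})"
  have box: "z \<in> box \<longleftrightarrow> (\<forall>i. fst z i \<in> {A..B}) \<and> (\<forall>i. snd z i \<in> {0..1})" for z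
    unfolding box_def by (cases z) (simp add: PiE_iff)
  define X where "X = box \<inter> (\<Inter>j<k. {z. mom j z = measure_pmf.expectation \<xi> (\<psi> j)})"
  have X: "z \<in> X \<longleftrightarrow> z \<in> box \<and> (\<forall>j<k. mom j z = measure_pmf.expectation \<xi> (\<psi> j))" for z
    by (auto simp: X_def)
  \<comment> \<open>Tychonoff's theorem for the product topology on sequences.\<close>
  have "compact (PiE UNIV (\<lambda>_. S) :: (nat \<Rightarrow> real) set)" if "compact S" for S
    using that compactin_PiE[of "\<lambda>_. euclidean" "UNIV :: nat set" "\<lambda>_. S"]
    by (simp add: euclidean_product_topology)
  then have "compact box"
    unfolding box_def by (intro compact_Times) auto
  moreover have "closed {z. mom j z = measure_pmf.expectation \<xi> (\<psi> j)}" if "j < k" for j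
    using that by (intro closed_Collect_eq cont_mom continuous_on_const) auto
  ultimately have "compact X"
    unfolding X_def by (intro compact_Int_closed closed_INT) auto
  have to_X: "\<exists>z\<in>X. measure_pmf.expectation \<zeta> (\<psi> k) \<le> mom k z"
    if \<zeta>: "design A B \<zeta>"
      "\<And>j. j < k \<Longrightarrow> measure_pmf.expectation \<zeta> (\<psi> j) = measure_pmf.expectation \<xi> (\<psi> j)" for \<zeta>
  proof -
    obtain \<zeta>' where \<zeta>': "design A B \<zeta>'" "card (set_pmf \<zeta>') \<le> Suc k"
      "\<And>j. j < k \<Longrightarrow> measure_pmf.expectation \<zeta>' (\<psi> j) = measure_pmf.expectation \<zeta> (\<psi> j)"
      "measure_pmf.expectation \<zeta> (\<psi> k) \<le> measure_pmf.expectation \<zeta>' (\<psi> k)"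
      using reduce_support[OF \<zeta>(1)] by blast
    obtain x w where xw: "\<And>i. x i \<in> {A..B}" "\<And>i. w i \<in> {0..1}"
      "\<And>f :: real \<Rightarrow> real. measure_pmf.expectation \<zeta>' f = (\<Sum>i<Suc k. w i * f (x i))"
      using design_as_indexed_sum[OF \<zeta>'(1,2) less_imp_le[OF interval]] by blast
    have mom_xw: "mom j (x, w) = measure_pmf.expectation \<zeta>' (\<psi> j)" for j
      using mom[of "(x, w)"] xw(1) by (simp only: xw(3) fst_conv snd_conv)
    have "(x, w) \<in> X"
      unfolding X box mom_xw using xw(1,2) \<zeta>(2) \<zeta>'(3) by simp
    then show ?thesis
      using \<zeta>'(4) mom_xw[of k] by (intro bexI[of _ "(x, w)"]) simp
  qed
  then have "X \<noteq> {}"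
    using assms by blast
  moreover have "continuous_on X (mom k)"
    using cont_mom[of k] continuous_on_subset by blast
  ultimately obtain z where z: "z \<in> X" "\<And>z'. z' \<in> X \<Longrightarrow> mom k z' \<le> mom k z"
    using continuous_attains_sup[OF \<open>compact X\<close>, of "mom k"] by blast
  have zin: "\<And>i. fst z i \<in> {A..B}" "\<And>i. snd z i \<in> {0..1}"
    using z(1) unfolding X box by blast+
  \<comment> \<open>The moment condition for \<open>\<psi> 0\<close> is the normalisation of the
    weights, so the maximising point does define a design.\<close>
  have "mom 0 z = measure_pmf.expectation \<xi> (\<psi> 0)"
    using z(1) order_pos unfolding X by simp
  also have "\<dots> = measure_pmf.expectation \<xi> (\<lambda>_. 1)"
    by (rule expectation_design_cong[OF assms const_one])
  finally have "(\<Sum>i<Suc k. snd z i) = 1"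
    unfolding mom[OF zin(1)] by (simp only: const_one[OF zin(1)]) simp
  then obtain \<xi>' where \<xi>': "design A B \<xi>'"
    "\<And>f :: real \<Rightarrow> real. measure_pmf.expectation \<xi>' f = (\<Sum>i<Suc k. snd z i * f (fst z i))"
    using design_from_indexed_sum[of "Suc k" "fst z" A B "snd z"] zin
    by (metis atLeastAtMost_iff)
  have \<xi>'_mom: "measure_pmf.expectation \<xi>' (\<psi> j) = mom j z" for j
    unfolding \<xi>'(2) mom[OF zin(1)] ..
  show thesis
  proof (rule that[OF \<xi>'(1)])
    show "measure_pmf.expectation \<xi>' (\<psi> j) = measure_pmf.expectation \<xi> (\<psi> j)" if "j < k" for j
      using z(1) that unfolding \<xi>'_mom X by blast
    show "measure_pmf.expectation \<zeta> (\<psi> k) \<le> measure_pmf.expectation \<xi>' (\<psi> k)"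
      if "design A B \<zeta>"
        "\<And>j. j < k \<Longrightarrow> measure_pmf.expectation \<zeta> (\<psi> j) = measure_pmf.expectation \<xi> (\<psi> j)" for \<zeta>
      unfolding \<xi>'_mom using to_X[OF that] z(2) by force
  qed
qed

section \<open>Support counts, the index and extremal designs\<close>

lemma card_minus_avoided:
  assumes "finite S"
  shows "card (S - avoided d) = card (S - {A, B}) +
    of_bool (A \<in> S \<and> d \<noteq> 1) + of_bool (B \<in> S \<and> even (k + d))"
proof -
  have "S - avoided d = (S - {A, B}) \<union> (S \<inter> ({A, B} - avoided d))"
    by (auto simp: avoided_def)
  then have "card (S - avoided d) = card (S - {A, B}) + card (S \<inter> ({A, B} - avoided d))"
    using assms by (metis (no_types, lifting) Diff_disjoint Int_Diff card_Un_disjoint disjoint_iff finite_Diff finite_Int Diff_iff Int_iff)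
  also have "card (S \<inter> ({A, B} - avoided d)) =
      of_bool (A \<in> S \<and> d \<noteq> 1) + of_bool (B \<in> S \<and> even (k + d))"
    using interval
    by (cases "A \<in> S"; cases "B \<in> S") (auto simp: avoided_def insert_Diff_if Int_insert_right)
  finally show ?thesis
    by simp
qed

lemma design_index_eq:
  "design_index A B \<xi> = real (card (set_pmf \<xi> - {A, B})) +
    (of_bool (A \<in> set_pmf \<xi>) + of_bool (B \<in> set_pmf \<xi>)) / 2"
  using interval
  by (cases "A \<in> set_pmf \<xi>"; cases "B \<in> set_pmf \<xi>") (auto simp: design_index_def)

text \<open>An endpoint that is not avoided counts fully in the cardinality but by one half in the
  index. Subtracting these halves from \<open>(k + 2 - d) div 2\<close> leaves exactly
  \<open>k / 2\<close> in all four parity cases.\<close>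

lemma design_index_ge:
  assumes "design A B \<xi>" "d \<le> 1" "(k + 2 - d) div 2 \<le> card (set_pmf \<xi> - avoided d)"
  shows "real k / 2 \<le> design_index A B \<xi>"
proof -
  have "finite (set_pmf \<xi>)"
    using assms(1) by (simp add: design_def)
  note card = card_minus_avoided[OF this, of d]
  define c where "c = card (set_pmf \<xi> - {A, B})"
  have "d = 0 \<or> d = 1"
    using assms(2) by auto
  moreover obtain m where "k = 2 * m \<or> k = 2 * m + 1"
    by (meson evenE oddE)
  ultimately show ?thesis
    using assms(3) unfolding card design_index_eq c_def[symmetric]
    by (cases "A \<in> set_pmf \<xi>"; cases "B \<in> set_pmf \<xi>") auto
qed

text \<open>Each avoided endpoint can add one half to the index and one point to the support beyond
  the counted points. The index bound is attained only if all avoided endpoints occur, which is how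
  they are forced into the support.\<close>

lemma design_index_le:
  assumes "design A B \<xi>" "d \<le> 1" "card (set_pmf \<xi> - avoided d) < (k + 2 - d) div 2"
  shows "design_index A B \<xi> \<le> real k / 2"
    and "real k / 2 \<le> design_index A B \<xi> \<Longrightarrow> avoided d \<subseteq> set_pmf \<xi>"
    and "2 * card (set_pmf \<xi>) \<le> k + of_bool (d = 1) + of_bool (odd (k + d))"
proof -
  have fin: "finite (set_pmf \<xi>)"
    using assms(1) by (simp add: design_def)
  note card = card_minus_avoided[OF fin, of d]
  have "set_pmf \<xi> = (set_pmf \<xi> - {A, B}) \<union> (set_pmf \<xi> \<inter> {A, B})"
    by blast
  then have "card (set_pmf \<xi>) = card (set_pmf \<xi> - {A, B}) + card (set_pmf \<xi> \<inter> {A, B})"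
    using fin by (metis Diff_Int_distrib2 Int_Diff card_Int_Diff add.commute finite_Int)
  also have "card (set_pmf \<xi> \<inter> {A, B}) = of_bool (A \<in> set_pmf \<xi>) + of_bool (B \<in> set_pmf \<xi>)"
    using interval by (cases "A \<in> set_pmf \<xi>"; cases "B \<in> set_pmf \<xi>") auto
  finally have card_supp: "card (set_pmf \<xi>) = card (set_pmf \<xi> - {A, B}) +
      (of_bool (A \<in> set_pmf \<xi>) + of_bool (B \<in> set_pmf \<xi>))" .
  define c where "c = card (set_pmf \<xi> - {A, B})"
  have d: "d = 0 \<or> d = 1"
    using assms(2) by auto
  obtain m where m: "k = 2 * m \<or> k = 2 * m + 1"
    by (meson evenE oddE)
  show "design_index A B \<xi> \<le> real k / 2"
    using d m assms(3) unfolding card design_index_eq c_def[symmetric]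
    by (cases "A \<in> set_pmf \<xi>"; cases "B \<in> set_pmf \<xi>") auto
  show "avoided d \<subseteq> set_pmf \<xi>" if "real k / 2 \<le> design_index A B \<xi>"
    using d m assms(3) that unfolding card design_index_eq c_def[symmetric]
    by (cases "A \<in> set_pmf \<xi>"; cases "B \<in> set_pmf \<xi>") (auto simp: avoided_def)
  show "2 * card (set_pmf \<xi>) \<le> k + of_bool (d = 1) + of_bool (odd (k + d))"
    using d m assms(3) unfolding card card_supp c_def[symmetric]
    by (cases "A \<in> set_pmf \<xi>"; cases "B \<in> set_pmf \<xi>") auto
qed

lemma unique_design:
  assumes "design A B \<xi>" "design_index A B \<xi> < real k / 2" "design A B \<zeta>"
    "\<And>j. j < k \<Longrightarrow> measure_pmf.expectation \<zeta> (\<psi> j) = measure_pmf.expectation \<xi> (\<psi> j)"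
  shows "\<zeta> = \<xi>"
proof (rule ccontr)
  assume "\<zeta> \<noteq> \<xi>"
  then obtain d where "d \<le> 1" "(k + 2 - d) div 2 \<le> card (set_pmf \<xi> - avoided d)"
    using different_design_same_moments[OF assms(1,3) _ assms(4)] by blast
  then show False
    using design_index_ge[OF assms(1)] assms(2) by fastforce
qed

text \<open>The maximiser of the \<open>\<psi> k\<close> moment cannot be improved, so its support
  is small in the sense of \<open>design_index_le\<close>.\<close>

lemma principal_design_exists:
  assumes \<xi>: "design A B \<xi>" "real k / 2 \<le> design_index A B \<xi>" and d: "d \<le> 1" "odd (k + d) \<longleftrightarrow> 0 < s"
  obtains \<xi>' where "design A B \<xi>'"
    "\<And>j. j < k \<Longrightarrow> measure_pmf.expectation \<xi>' (\<psi> j) = measure_pmf.expectation \<xi> (\<psi> j)"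
    "measure_pmf.expectation \<xi> (\<psi> k) \<le> measure_pmf.expectation \<xi>' (\<psi> k)"
    "design_index A B \<xi>' \<le> real k / 2" "avoided d \<subseteq> set_pmf \<xi>'"
    "2 * card (set_pmf \<xi>') \<le> k + of_bool (d = 1) + of_bool (odd (k + d))"
proof -
  obtain \<xi>' where \<xi>': "design A B \<xi>'"
    "\<And>j. j < k \<Longrightarrow> measure_pmf.expectation \<xi>' (\<psi> j) = measure_pmf.expectation \<xi> (\<psi> j)"
    and max: "\<And>\<zeta>. \<lbrakk>design A B \<zeta>;
        \<And>j. j < k \<Longrightarrow> measure_pmf.expectation \<zeta> (\<psi> j) = measure_pmf.expectation \<xi> (\<psi> j)\<rbrakk>
      \<Longrightarrow> measure_pmf.expectation \<zeta> (\<psi> k) \<le> measure_pmf.expectation \<xi>' (\<psi> k)"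
    using maximizing_design_exists[OF \<xi>(1)] by blast
  have small: "card (set_pmf \<xi>' - avoided d) < (k + 2 - d) div 2"
  proof (rule ccontr)
    assume "\<not> ?thesis"
    then obtain \<zeta> where \<zeta>: "design A B \<zeta>"
      "\<And>j. j < k \<Longrightarrow> measure_pmf.expectation \<zeta> (\<psi> j) = measure_pmf.expectation \<xi>' (\<psi> j)"
      "measure_pmf.expectation \<xi>' (\<psi> k) < measure_pmf.expectation \<zeta> (\<psi> k)"
      using improvable_design[OF \<xi>'(1) d] by auto
    have "measure_pmf.expectation \<zeta> (\<psi> k) \<le> measure_pmf.expectation \<xi>' (\<psi> k)"
      using \<zeta>(2) \<xi>'(2) by (intro max[OF \<zeta>(1)]) simp
    then show False
      using \<zeta>(3) by simp
  qed
  \<comment> \<open>Uniqueness is applied with the maximiser as the given design: an index below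
    \<open>k / 2\<close> would force \<open>\<xi> = \<xi>'\<close>, against the index of
    \<open>\<xi>\<close>.\<close>
  have "real k / 2 \<le> design_index A B \<xi>'"
  proof (rule ccontr)
    assume *: "\<not> ?thesis"
    then have "\<xi> = \<xi>'"
      using \<xi>'(2) by (intro unique_design[OF \<xi>'(1) _ \<xi>(1)]) auto
    then show False
      using * \<xi>(2) by simp
  qed
  then show thesis
    using that[OF \<xi>'] max[OF \<xi>(1)] design_index_le[OF \<xi>'(1) d(1) small] by blast
qed

end

section \<open>The Loewner ordering\<close>

lemma nonneg_definite_single_entry:
  fixes D :: "real^'p^'p"
  assumes "\<And>i j. (i, j) \<noteq> (l, l) \<Longrightarrow> D $ i $ j = 0" "0 \<le> D $ l $ l"
  shows "nonneg_definite D"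
  unfolding nonneg_definite_def
proof (intro conjI allI)
  have D: "D $ i $ j = (if i = l then if j = l then D $ l $ l else 0 else 0)" for i j
    using assms(1)[of i j] by auto
  show "transpose D = D"
    unfolding vec_eq_iff transpose_def by (subst (1 2) D) auto
  fix v :: "real^'p"
  have row: "(D *v v) $ i = (if i = l then D $ l $ l * v $ l else 0)" for i
  proof (cases "i = l")
    case True
    have "(\<Sum>j\<in>UNIV. D $ l $ j * v $ j) = (\<Sum>j\<in>{l}. D $ l $ j * v $ j)"
      using assms(1) by (intro sum.mono_neutral_right) auto
    then show ?thesis
      using True by (simp add: matrix_vector_mult_def)
  next
    case False
    then show ?thesis
      using assms(1) by (simp add: matrix_vector_mult_def)
  qed
  have "v \<bullet> (D *v v) = D $ l $ l * (v $ l)\<^sup>2"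
    by (simp add: inner_vec_def row if_distrib[of "(*) _"] power2_eq_square mult_ac cong: if_cong)
  then show "0 \<le> v \<bullet> (D *v v)"
    using assms(2) by simp
qed

text \<open>The quadratic form of \<open>P ** D ** transpose P\<close> at \<open>v\<close> is that
  of \<open>D\<close> at \<open>v v* P\<close>, the transpose of \<open>P\<close> applied to
  \<open>v\<close>.\<close>

lemma loewner_le_congruence:
  fixes P M N :: "real^'p^'p"
  assumes "loewner_le M N"
  shows "loewner_le (P ** M ** transpose P) (P ** N ** transpose P)"
proof -
  define D where "D = N - M"
  have "P ** N ** transpose P - P ** M ** transpose P = P ** D ** transpose P"
    by (simp add: D_def matrix_matrix_mult_def vec_eq_iff right_diff_distrib left_diff_distrib
        sum_subtractf)
  moreover have "nonneg_definite (P ** D ** transpose P)"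
    unfolding nonneg_definite_def
  proof (intro conjI allI)
    have D: "transpose D = D" "\<And>v. 0 \<le> v \<bullet> (D *v v)"
      using assms by (auto simp: loewner_le_def nonneg_definite_def D_def)
    show "transpose (P ** D ** transpose P) = P ** D ** transpose P"
      by (simp add: matrix_transpose_mul D(1) matrix_mul_assoc)
    fix v :: "real^'p"
    have "v \<bullet> ((P ** D ** transpose P) *v v) = (v v* P) \<bullet> (D *v (v v* P))"
      by (simp add: dot_lmul_matrix matrix_vector_mul_assoc[symmetric] transpose_matrix_vector)
    then show "0 \<le> v \<bullet> ((P ** D ** transpose P) *v v)"
      using D(2) by simp
  qed
  ultimately show ?thesis
    by (simp add: loewner_le_def)
qed

section \<open>The Chebyshev system of the functions \<open>w\<^sub>j\<close>\<close>

text \<open>This is the iterate \<open>D_(i-1) ... D_0\<close> applied to \<open>\<psi> j\<close>;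
  for \<open>i = j\<close> and positive \<open>j\<close> it is
  \<open>w_seq S \<psi> j\<close>.\<close>

abbreviation reduced :: "real set \<Rightarrow> (nat \<Rightarrow> real \<Rightarrow> real) \<Rightarrow> nat \<Rightarrow> nat \<Rightarrow> real \<Rightarrow> real" where
  "reduced S \<psi> i j \<equiv> fold (\<lambda>r f. quot_deriv S (w_seq S \<psi> r) f) [0..<i] (\<psi> j)"

lemma reduced_has_derivative:
  assumes "w_seq_well_defined S \<psi> k" "i < j" "j \<le> k" "x \<in> S"
  shows "((\<lambda>x. reduced S \<psi> i j x / w_seq S \<psi> i x) has_real_derivative reduced S \<psi> (Suc i) j x)
    (at x within S)"
proof -
  obtain j' where "j = Suc j'"
    using assms(2) by (cases j) auto
  then have "(\<lambda>x. reduced S \<psi> i j x / w_seq S \<psi> i x) differentiable (at x within S)"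
    using assms unfolding w_seq_well_defined_def differentiable_on_def by auto
  then show ?thesis
    by (simp add: has_real_derivative_iff_has_vector_derivative vector_derivative_works quot_deriv_def)
qed

declare w_seq.simps(2) [simp del]

locale w_sequence =
  fixes A B :: real and \<psi> :: "nat \<Rightarrow> real \<Rightarrow> real" and k :: nat
  assumes interval: "A < B"
    and const_one: "x \<in> {A..B} \<Longrightarrow> \<psi> 0 x = 1"
    and well_defined: "w_seq_well_defined {A..B} \<psi> k"
    and nonzero: "\<lbrakk>1 \<le> j; j \<le> k; x \<in> {A..B}\<rbrakk> \<Longrightarrow> w_seq {A..B} \<psi> j x \<noteq> 0"
begin

abbreviation w where "w \<equiv> w_seq {A..B} \<psi>"

text \<open>Each such \<open>w j\<close> is by construction the derivative of a quotient, and it has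
  no zero, so Darboux's property applies.\<close>

lemma w_same_sign:
  assumes "1 \<le> j" "j \<le> k" "x \<in> {A..B}" "y \<in> {A..B}"
  shows "0 < w j x * w j y"
proof -
  obtain i where j: "j = Suc i"
    using assms(1) by (cases j) auto
  have "w j = reduced {A..B} \<psi> (Suc i) j"
    unfolding j by (rule w_seq.simps(2))
  then have "((\<lambda>x. reduced {A..B} \<psi> i j x / w i x) has_real_derivative w j t) (at t within {A..B})"
    if "t \<in> {A..B}" for t
    using reduced_has_derivative[OF well_defined _ assms(2) that, of i] j by simp
  then show ?thesis
    by (rule nonzero_derivative_same_sign[OF _ nonzero[OF assms(1,2)] assms(3,4)])
qed

text \<open>Dividing by \<open>w i\<close> and differentiating removes one term at a time from the
  combination, until only the constant \<open>c m\<close> is left. Its sign is traced through these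
  steps by \<open>iterated_mean_value_sign\<close>.\<close>

lemma alternating_combination_leading_sign:
  assumes "m \<le> k" and y: "strict_mono_on {..m} y" "y ` {..m} \<subseteq> {A..B}"
    and alt: "\<And>i. i \<le> m \<Longrightarrow> 0 \<le> (-1) ^ (m - i) * (\<Sum>j\<le>m. c j * \<psi> j (y i))"
  shows "0 \<le> c m * (\<Prod>i<m. w (Suc i) A)"
    and "\<exists>i\<le>m. (\<Sum>j\<le>m. c j * \<psi> j (y i)) \<noteq> 0 \<Longrightarrow> 0 < c m * (\<Prod>i<m. w (Suc i) A)"
proof -
  \<comment> \<open>Normalised so that the term of index \<open>i\<close> is the constant
    \<open>c i\<close>; the term of index \<open>Suc i\<close> has derivative
    \<open>c (Suc i) * w (Suc i)\<close>, whence the factor \<open>w (Suc i)\<close> in the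
    derivative of \<open>v i\<close>.\<close>
  define v where "v i x = c i + (\<Sum>j\<in>{i<..m}. c j * (reduced {A..B} \<psi> i j x / w i x))" for i x
  have v0: "v 0 x = (\<Sum>j\<le>m. c j * \<psi> j x)" if "x \<in> {A..B}" for x
  proof -
    have "{..m} = insert 0 {0<..m}"
      by auto
    then show ?thesis
      using that by (simp add: v_def const_one)
  qed
  have yAB: "y i \<in> {A..B}" if "i \<le> m" for i
    using y(2) that by auto
  have deriv: "(v i has_real_derivative w (Suc i) x * v (Suc i) x) (at x within {A..B})"
    if "i < m" "x \<in> {A..B}" for i x
  proof -
    have "(v i has_real_derivative 0 + (\<Sum>j\<in>{i<..m}. c j * reduced {A..B} \<psi> (Suc i) j x))
        (at x within {A..B})"
      unfolding v_def using that \<open>m \<le> k\<close>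
      by (intro DERIV_add DERIV_const DERIV_sum DERIV_cmult reduced_has_derivative[OF well_defined]) auto
    moreover have "{i<..m} = insert (Suc i) {Suc i<..m}"
      using that by auto
    moreover have "w (Suc i) x \<noteq> 0"
      using that nonzero \<open>m \<le> k\<close> by simp
    moreover have "w (Suc i) x = reduced {A..B} \<psi> (Suc i) (Suc i) x"
      by (simp only: w_seq.simps(2))
    ultimately show ?thesis
      by (simp add: v_def distrib_left sum_distrib_left mult_ac del: upt_Suc)
  qed
  have vm: "v m x = c m" for x
    by (simp add: v_def)
  have "\<exists>x\<in>{A..B}. 0 \<le> v m x * (\<Prod>i<m. w (Suc i) A) \<and>
      ((\<exists>i\<le>m. v 0 (y i) \<noteq> 0) \<longrightarrow> 0 < v m x * (\<Prod>i<m. w (Suc i) A))"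
    using alt v0[OF yAB] \<open>m \<le> k\<close> interval
    by (intro iterated_mean_value_sign[where \<epsilon> = "\<lambda>i. w (Suc i) A" and w = "\<lambda>i. w (Suc i)"]
        deriv w_same_sign y) auto
  then show "0 \<le> c m * (\<Prod>i<m. w (Suc i) A)"
    and "\<exists>i\<le>m. (\<Sum>j\<le>m. c j * \<psi> j (y i)) \<noteq> 0 \<Longrightarrow> 0 < c m * (\<Prod>i<m. w (Suc i) A)"
    using v0[OF yAB] unfolding vm by force+
qed

text \<open>The weak sign statement for \<open>c\<close> and for \<open>- c\<close> forces the top
  coefficient to vanish; the last function and the last node are then dropped.\<close>

lemma vanishing_combination_trivial:
  assumes "m \<le> k" "strict_mono_on {..m} y" "y ` {..m} \<subseteq> {A..B}"
    and "\<And>i. i \<le> m \<Longrightarrow> (\<Sum>j\<le>m. c j * \<psi> j (y i)) = 0"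
  shows "j \<le> m \<Longrightarrow> c j = 0"
  using assms
proof (induction m arbitrary: j)
  case 0
  then show ?case
    using const_one[of "y 0"] by auto
next
  case (Suc m)
  let ?P = "\<Prod>i<Suc m. w (Suc i) A"
  have "0 \<le> c (Suc m) * ?P" "0 \<le> (- c (Suc m)) * ?P"
    using alternating_combination_leading_sign(1)[OF Suc.prems(2-4), of c]
      alternating_combination_leading_sign(1)[OF Suc.prems(2-4), of "\<lambda>j. - c j"] Suc.prems(5)
    by (auto simp: sum_negf simp del: prod.lessThan_Suc sum.atMost_Suc)
  then have "c (Suc m) * ?P = 0"
    by linarith
  moreover have "?P \<noteq> 0"
    using nonzero interval Suc.prems(2) by (simp del: prod.lessThan_Suc)
  ultimately have c: "c (Suc m) = 0"
    by (simp del: prod.lessThan_Suc)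
  have "c j = 0" if "j \<le> m" for j
  proof (rule Suc.IH[OF that])
    show "strict_mono_on {..m} y"
      using Suc.prems(3) by (auto simp: strict_mono_on_def)
    show "(\<Sum>j\<le>m. c j * \<psi> j (y i)) = 0" if "i \<le> m" for i
      using Suc.prems(5)[of i] that c by simp
  qed (use Suc.prems in auto)
  then show ?case
    using c Suc.prems(1) le_Suc_eq by auto
qed

lemma w_sequence_chebyshev_system:
  assumes "1 \<le> k"
  shows "chebyshev_system A B \<psi> k (\<Prod>j=1..k. w j A)"
proof
  show "continuous_on {A..B} (\<psi> j)" if "j \<le> k" for j
  proof (cases "j = 0")
    case True
    then show ?thesis
      using const_one continuous_on_cong[of "{A..B}" "{A..B}" "\<psi> 0" "\<lambda>_. 1"] by simp
  next
    case False
    then have "(\<psi> j has_real_derivative reduced {A..B} \<psi> (Suc 0) j x) (at x within {A..B})"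
      if "x \<in> {A..B}" for x
      using reduced_has_derivative[OF well_defined _ \<open>j \<le> k\<close> that, of 0] by simp
    then show ?thesis
      by (rule DERIV_continuous_on)
  qed
  show "c j = 0" if "strict_mono_on {..k} y" "y ` {..k} \<subseteq> {A..B}"
    "\<And>i. i \<le> k \<Longrightarrow> (\<Sum>j\<le>k. c j * \<psi> j (y i)) = 0" "j \<le> k" for c y j
    using vanishing_combination_trivial[OF order.refl that] .
  show "0 < c k * (\<Prod>j=1..k. w j A)" if "strict_mono_on {..k} y" "y ` {..k} \<subseteq> {A..B}"
    "\<And>i. i \<le> k \<Longrightarrow> 0 \<le> (-1) ^ (k - i) * (\<Sum>j\<le>k. c j * \<psi> j (y i))"
    "\<exists>i\<le>k. (\<Sum>j\<le>k. c j * \<psi> j (y i)) \<noteq> 0" for c y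
    using alternating_combination_leading_sign(2)[OF order.refl that]
    unfolding prod.atLeast1_atMost_eq One_nat_def .
qed (use interval const_one assms in auto)

end

section \<open>Loewner improvement and the cases by index, parity and sign of
  \<open>F\<close>\<close>

theorem theorem3p4:
  fixes A B :: real
    and \<eta> :: "real \<Rightarrow> real^'p \<Rightarrow> real" and \<Theta> :: "(real^'p) set" and \<theta> :: "real^'p"
    and g :: "real \<Rightarrow> real^'p"
    and P :: "real^'p^'p" and \<Psi> :: "'p \<Rightarrow> 'p \<Rightarrow> real \<Rightarrow> real"
    and \<psi> :: "nat \<Rightarrow> real \<Rightarrow> real" and k :: nat and l :: 'p
    and F :: "real \<Rightarrow> real"
  assumes "A < B"
    and "\<theta> \<in> \<Theta>"
    and "\<And>x. x \<in> {A..B} \<Longrightarrow> parameter_gradient \<eta> \<Theta> \<theta> x (g x)"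
    and "\<And>i j x. x \<in> {A..B} \<Longrightarrow> \<Psi> i j x = \<Psi> j i x"
    and "invertible P"
    and "\<And>\<xi>. design A B \<xi> \<Longrightarrow> info_matrix g \<xi> = P ** moment_matrix \<Psi> \<xi> ** transpose P"
    and "1 \<le> k"
    and "bij_betw (\<lambda>m. restrict (\<psi> m) {A..B}) {1..k}
           {restrict (\<Psi> i j) {A..B} | i j. \<not> \<Psi> i j constant_on {A..B}}"
    and "\<And>i j. (\<forall>x\<in>{A..B}. \<Psi> i j x = \<psi> k x) \<longleftrightarrow> (i, j) = (l, l)"
    and "\<And>x. x \<in> {A..B} \<Longrightarrow> \<psi> 0 x = 1"
    and "\<And>j. j \<in> {1..k} \<Longrightarrow> times_cont_diff_on (j + 1) (\<psi> j) {A..B}"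
    and "w_seq_well_defined {A..B} \<psi> k"
    and F_def: "\<And>x. F x = (\<Prod>j=1..k. w_seq {A..B} \<psi> j x)"
    and "\<And>x. x \<in> {A..B} \<Longrightarrow> F x \<noteq> 0"
  shows "\<forall>\<xi>. design A B \<xi> \<longrightarrow>
    (\<exists>\<xi>'. design A B \<xi>' \<and> design_index A B \<xi>' \<le> real k / 2
      \<and> loewner_le (info_matrix g \<xi>) (info_matrix g \<xi>')
      \<and> (design_index A B \<xi> < real k / 2 \<longrightarrow>
           \<xi>' = \<xi> \<and>
           (\<forall>\<zeta>. design A B \<zeta> \<and>
                (\<forall>i\<in>{0..k-1}. measure_pmf.expectation \<zeta> (\<psi> i) = measure_pmf.expectation \<xi> (\<psi> i))
              \<longrightarrow> \<zeta> = \<xi>))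
      \<and> (design_index A B \<xi> \<ge> real k / 2 \<longrightarrow>
           (odd k \<and> (\<forall>x\<in>{A..B}. F x < 0) \<longrightarrow>
              real (card (set_pmf \<xi>')) \<le> (real k + 1) / 2 \<and> A \<in> set_pmf \<xi>')
         \<and> (odd k \<and> (\<forall>x\<in>{A..B}. F x > 0) \<longrightarrow>
              real (card (set_pmf \<xi>')) \<le> (real k + 1) / 2 \<and> B \<in> set_pmf \<xi>')
         \<and> (even k \<and> (\<forall>x\<in>{A..B}. F x < 0) \<longrightarrow>
              real (card (set_pmf \<xi>')) \<le> real k / 2)
         \<and> (even k \<and> (\<forall>x\<in>{A..B}. F x > 0) \<longrightarrow>
              real (card (set_pmf \<xi>')) \<le> real k / 2 + 1 \<and> {A, B} \<subseteq> set_pmf \<xi>')))"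
proof (intro allI impI)
  fix \<xi> assume \<xi>: "design A B \<xi>"
  note AB = assms(1) and info = assms(6) and k = assms(7) and distinct_functions = assms(8)
    and only_ll = assms(9) and F_nz = assms(14)
  have AB_mem: "A \<in> {A..B}"
    using AB by simp
  interpret w_sequence A B \<psi> k
  proof
    show "w_seq {A..B} \<psi> j x \<noteq> 0" if "1 \<le> j" "j \<le> k" "x \<in> {A..B}" for j x
      using F_nz[OF that(3)] that(1,2) unfolding F_def by (auto simp: prod_zero_iff)
  qed (use assms in auto)
  have "chebyshev_system A B \<psi> k (F A)"
    unfolding F_def by (rule w_sequence_chebyshev_system[OF k])
  then interpret C: chebyshev_system A B \<psi> k "F A" .
  have loewner: "loewner_le (info_matrix g \<xi>) (info_matrix g \<zeta>)"
    if \<zeta>: "design A B \<zeta>"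
      "\<And>j. j < k \<Longrightarrow> measure_pmf.expectation \<zeta> (\<psi> j) = measure_pmf.expectation \<xi> (\<psi> j)"
      "measure_pmf.expectation \<xi> (\<psi> k) \<le> measure_pmf.expectation \<zeta> (\<psi> k)" for \<zeta>
    unfolding info[OF \<xi>] info[OF \<zeta>(1)]
  proof (rule loewner_le_congruence, unfold loewner_le_def,
      rule nonneg_definite_single_entry[where l = l])
    have ll: "\<Psi> l l x = \<psi> k x" if "x \<in> {A..B}" for x
      using only_ll[of l l] that by blast
    show "0 \<le> (moment_matrix \<Psi> \<zeta> - moment_matrix \<Psi> \<xi>) $ l $ l"
      using \<zeta>(3) expectation_design_cong[OF \<xi> ll] expectation_design_cong[OF \<zeta>(1) ll]
      by (simp add: moment_matrix_def)
    fix i j assume ij: "(i, j) \<noteq> (l, l)"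
    have "measure_pmf.expectation \<zeta> (\<Psi> i j) = measure_pmf.expectation \<xi> (\<Psi> i j)"
    proof (cases "\<Psi> i j constant_on {A..B}")
      case True
      then obtain c where c: "\<And>x. x \<in> {A..B} \<Longrightarrow> \<Psi> i j x = c"
        unfolding constant_on_def by blast
      show ?thesis
        using expectation_design_cong[OF \<xi> c] expectation_design_cong[OF \<zeta>(1) c] by simp
    next
      case False
      then have "restrict (\<Psi> i j) {A..B} \<in> (\<lambda>m. restrict (\<psi> m) {A..B}) ` {1..k}"
        using bij_betw_imp_surj_on[OF distinct_functions] by blast
      then obtain m where m: "m \<in> {1..k}" "restrict (\<Psi> i j) {A..B} = restrict (\<psi> m) {A..B}"
        by blast
      then have eq: "\<Psi> i j x = \<psi> m x" if "x \<in> {A..B}" for x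
        using that by (metis restrict_apply')
      \<comment> \<open>Only the entry \<open>(l, l)\<close> equals \<open>\<psi> k\<close>, so
        every other nonconstant entry has a prescribed moment.\<close>
      then have "m \<noteq> k"
        using only_ll[of i j] ij by blast
      then have "m < k"
        using m(1) by simp
      then show ?thesis
        using \<zeta>(2) expectation_design_cong[OF \<xi> eq] expectation_design_cong[OF \<zeta>(1) eq] by simp
    qed
    then show "(moment_matrix \<Psi> \<zeta> - moment_matrix \<Psi> \<xi>) $ i $ j = 0"
      by (simp add: moment_matrix_def)
  qed
  show "\<exists>\<xi>'. design A B \<xi>' \<and> design_index A B \<xi>' \<le> real k / 2
      \<and> loewner_le (info_matrix g \<xi>) (info_matrix g \<xi>')
      \<and> (design_index A B \<xi> < real k / 2 \<longrightarrow>
           \<xi>' = \<xi> \<and>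
           (\<forall>\<zeta>. design A B \<zeta> \<and>
                (\<forall>i\<in>{0..k-1}. measure_pmf.expectation \<zeta> (\<psi> i) = measure_pmf.expectation \<xi> (\<psi> i))
              \<longrightarrow> \<zeta> = \<xi>))
      \<and> (design_index A B \<xi> \<ge> real k / 2 \<longrightarrow>
           (odd k \<and> (\<forall>x\<in>{A..B}. F x < 0) \<longrightarrow>
              real (card (set_pmf \<xi>')) \<le> (real k + 1) / 2 \<and> A \<in> set_pmf \<xi>')
         \<and> (odd k \<and> (\<forall>x\<in>{A..B}. F x > 0) \<longrightarrow>
              real (card (set_pmf \<xi>')) \<le> (real k + 1) / 2 \<and> B \<in> set_pmf \<xi>')
         \<and> (even k \<and> (\<forall>x\<in>{A..B}. F x < 0) \<longrightarrow>
              real (card (set_pmf \<xi>')) \<le> real k / 2)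
         \<and> (even k \<and> (\<forall>x\<in>{A..B}. F x > 0) \<longrightarrow>
              real (card (set_pmf \<xi>')) \<le> real k / 2 + 1 \<and> {A, B} \<subseteq> set_pmf \<xi>'))"
  proof (cases "design_index A B \<xi> < real k / 2")
    case True
    have "\<zeta> = \<xi>" if "design A B \<zeta>"
      "\<forall>i\<in>{0..k-1}. measure_pmf.expectation \<zeta> (\<psi> i) = measure_pmf.expectation \<xi> (\<psi> i)" for \<zeta>
      using that k by (intro C.unique_design[OF \<xi> True]) auto
    then show ?thesis
      using \<xi> True loewner[OF \<xi>] by (intro exI[of _ \<xi>]) auto
  next
    case False
    \<comment> \<open>The parity solving \<open>odd (k + d) \<longleftrightarrow> 0 < F A\<close>.
      For negative \<open>F\<close> the avoided endpoints are \<open>A\<close> if \<open>k\<close>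
      is odd and none if \<open>k\<close> is even; for positive \<open>F\<close> they are
      \<open>B\<close> if \<open>k\<close> is odd and both if \<open>k\<close> is even.\<close>
    define d :: nat where "d = (if odd k \<longleftrightarrow> 0 < F A then 0 else 1)"
    have d: "d \<le> 1" "odd (k + d) \<longleftrightarrow> 0 < F A"
      by (auto simp: d_def)
    obtain \<xi>' where \<xi>': "design A B \<xi>'"
      "\<And>j. j < k \<Longrightarrow> measure_pmf.expectation \<xi>' (\<psi> j) = measure_pmf.expectation \<xi> (\<psi> j)"
      "measure_pmf.expectation \<xi> (\<psi> k) \<le> measure_pmf.expectation \<xi>' (\<psi> k)"
      "design_index A B \<xi>' \<le> real k / 2" "C.avoided d \<subseteq> set_pmf \<xi>'"
      "2 * card (set_pmf \<xi>') \<le> k + of_bool (d = 1) + of_bool (odd (k + d))"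
      using C.principal_design_exists[OF \<xi> _ d] False by (metis not_less)
    have card: "2 * real (card (set_pmf \<xi>')) \<le> real k + of_bool (d = 1) + of_bool (odd (k + d))"
      using of_nat_mono[OF \<xi>'(6), where 'a = real] by simp
    have neg: "d = of_bool (odd k)" "even (k + d)" if "\<forall>x\<in>{A..B}. F x < 0"
    proof -
      have "\<not> 0 < F A"
        using that AB_mem by fastforce
      then show "d = of_bool (odd k)" "even (k + d)"
        using d(2) by (auto simp: d_def)
    qed
    have pos: "d = of_bool (even k)" "odd (k + d)" if "\<forall>x\<in>{A..B}. F x > 0"
      using that AB_mem d(2) by (auto simp: d_def)
    show ?thesis
      using \<xi>' loewner[OF \<xi>'(1-3)] False card neg pos
      by (intro exI[of _ \<xi>']) (auto simp: C.avoided_def)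
  qed
qed

end
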